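(* Let $\Omega$ be a compact metric space and $\varphi:\Omega\to\Omega$ a continuous map such that $(\Omega,\varphi)$ is tame. Then: (i) for every ergodic operator net $\{V_\alpha\}\subset\mathcal{L}(X^* )$ there exist indices $\alpha(1),\alpha(2),\dots$ such that the sequence $\{V_{\alpha(n)}\}$ is ergodic and converges in the $\mathrm{W^*O}$-topology; (ii) every ergodic operator sequence $\{V_n\}\subset\mathcal{L}(X^* )$ contains a subsequence which is ergodic and converges in the $\mathrm{W^*O}$-topology. In particular, the sequence of Cesàro means $\frac{1}{n+1}(I+V+\dots+V^n)$ contains a $\mathrm{W^*O}$-convergent subsequence.
   Context: $X=C(\Omega)$ with sup norm, $X^*$ the space of Radon measures, pairing $(x,\mu)$. $Ux=x\circ\varphi$ (Koopman operator), $V=U^*\in\mathcal{L}(X^* )$. The $\mathrm{W^*O}$-topology on $\mathcal{L}(X^* )$: $T_\alpha\to T$ iff $(x,T_\alpha\mu)\to(x,T\mu)$ for all $x\in X,\mu\in X^*$. A net $\{V_\alpha\}\subseteq\operatorname{co}\{V^n:n\in\mathbb{N}_0\}$ is ergodic if $(x,(\operatorname{Id}-V)V_\alpha\mu)\to0$ for all $x\in X,\mu\in X^*$. The system $(\Omega,\varphi)$ is called tame if for every $x\in X$ and every strictly increasing sequence $\{n(k)\}\subseteq\mathbb{N}_0$ one has $\inf_a\|\sum_{k}a_k\, x\circ\varphi^{n(k)}\|_X=0$, where the infimum is over finitely supported scalar sequences $a$ with $\sum_k|a_k|=1$. *)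

theory Defs
  imports "HOL-Analysis.Analysis"
begin

(* X = C(Omega) with sup norm is the type of bounded continuous functions 'a => real;
   its dual X-dual is the type of bounded linear functionals on X (Riesz: Radon measures);
   L(X-dual) is the type of bounded linear operators on X*. Pairing (x, mu) = blinfun_apply mu x. *)

type_synonym 'a dualC = "('a \<Rightarrow>\<^sub>C real) \<Rightarrow>\<^sub>L real"
type_synonym 'a opdualC = "'a dualC \<Rightarrow>\<^sub>L 'a dualC"

definition koopman :: "('a::metric_space \<Rightarrow> 'a) \<Rightarrow> ('a \<Rightarrow>\<^sub>C real) \<Rightarrow>\<^sub>L ('a \<Rightarrow>\<^sub>C real)" where
  "koopman \<phi> = Blinfun (\<lambda>x. Bcontfun (\<lambda>\<omega>. apply_bcontfun x (\<phi> \<omega>)))"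

definition dual_koopman :: "('a::metric_space \<Rightarrow> 'a) \<Rightarrow> 'a opdualC" where
  "dual_koopman \<phi> = Blinfun (\<lambda>\<mu>. \<mu> o\<^sub>L koopman \<phi>)"

definition op_pow :: "('b::real_normed_vector \<Rightarrow>\<^sub>L 'b) \<Rightarrow> nat \<Rightarrow> 'b \<Rightarrow>\<^sub>L 'b" where
  "op_pow T n = ((\<lambda>S. T o\<^sub>L S) ^^ n) id_blinfun"

definition tame :: "('a::metric_space \<Rightarrow> 'a) \<Rightarrow> bool" where
  "tame \<phi> \<longleftrightarrow> (\<forall>(x::'a \<Rightarrow>\<^sub>C real) (n::nat \<Rightarrow> nat). strict_mono n \<longrightarrow>
     (INF aN \<in> {(a::nat \<Rightarrow> real, N::nat). (\<Sum>k<N. \<bar>a k\<bar>) = 1}.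
        norm (\<Sum>k<snd aN. fst aN k *\<^sub>R blinfun_apply (op_pow (koopman \<phi>) (n k)) x)) = 0)"

definition directed_preorder :: "('i \<Rightarrow> 'i \<Rightarrow> bool) \<Rightarrow> bool" where
  "directed_preorder le \<longleftrightarrow> (\<forall>a. le a a) \<and> (\<forall>a b c. le a b \<longrightarrow> le b c \<longrightarrow> le a c)
      \<and> (\<exists>a. le a a) \<and> (\<forall>a b. \<exists>c. le a c \<and> le b c)"

definition net_tendsto :: "('i \<Rightarrow> 'i \<Rightarrow> bool) \<Rightarrow> ('i \<Rightarrow> real) \<Rightarrow> real \<Rightarrow> bool" where
  "net_tendsto le f L \<longleftrightarrow> (\<forall>e>0. \<exists>a0. \<forall>a. le a0 a \<longrightarrow> \<bar>f a - L\<bar> < e)"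

definition ergodic_net :: "('a::metric_space \<Rightarrow> 'a) \<Rightarrow> ('i \<Rightarrow> 'i \<Rightarrow> bool) \<Rightarrow> ('i \<Rightarrow> 'a opdualC) \<Rightarrow> bool" where
  "ergodic_net \<phi> le W \<longleftrightarrow>
     (\<forall>a. W a \<in> convex hull (range (op_pow (dual_koopman \<phi>)))) \<and>
     (\<forall>x \<mu>. net_tendsto le
        (\<lambda>a. blinfun_apply (blinfun_apply ((id_blinfun - dual_koopman \<phi>) o\<^sub>L W a) \<mu>) x) 0)"

definition ergodic_seq :: "('a::metric_space \<Rightarrow> 'a) \<Rightarrow> (nat \<Rightarrow> 'a opdualC) \<Rightarrow> bool" where
  "ergodic_seq \<phi> W \<longleftrightarrow> ergodic_net \<phi> (\<le>) W"

definition wso_tendsto :: "(nat \<Rightarrow> 'a::metric_space opdualC) \<Rightarrow> 'a opdualC \<Rightarrow> bool" where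
  "wso_tendsto W T \<longleftrightarrow> (\<forall>x \<mu>. (\<lambda>n. blinfun_apply (blinfun_apply (W n) \<mu>) x)
        \<longlonglongrightarrow> blinfun_apply (blinfun_apply T \<mu>) x)"

definition wso_convergent :: "(nat \<Rightarrow> 'a::metric_space opdualC) \<Rightarrow> bool" where
  "wso_convergent W \<longleftrightarrow> (\<exists>T. wso_tendsto W T)"

definition cesaro :: "('a::metric_space \<Rightarrow> 'a) \<Rightarrow> nat \<Rightarrow> 'a opdualC" where
  "cesaro \<phi> n = (1 / real (n + 1)) *\<^sub>R (\<Sum>k\<le>n. op_pow (dual_koopman \<phi>) k)"

end

theory Submission
  imports Defs "HOL-Probability.Probability"
begin

text \<open>
  The operators in the convex hull of the powers of \<open>V\<close> are adjoints of operators \<open>w\<close> in the convex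
  hull of the powers of \<open>U\<close>. Tameness excludes independent subsequences of an orbit
  \<open>(U\<^sup>k x)\<close>, since these span \<open>\<ell>\<^sup>1\<close>; by Rosenthal's dichotomy every sequence of the orbit
  has a pointwise convergent subsequence. This passes to the convex hull of the orbit: an independent
  sequence in the hull carries a coin-tossing measure for which it is \<open>L\<^sup>1\<close>-separated, while
  dominated convergence makes the orbit, hence its convex hull, totally bounded in \<open>L\<^sup>1\<close>.
  A diagonal argument over a dense sequence of \<open>C(\<Omega>)\<close> and the fact that bounded pointwise
  convergence in \<open>C(\<Omega>)\<close> is weak convergence (proved by Simons' inequality, without representing
  measures) give the convergent subsequences.

  For nets, ergodicity says that 0 is in the pointwise closure of the functions
  \<open>w\<^sub>\<alpha> (x - U x)\<close>, and as in the theorem of Bourgain, Fremlin and Talagrand it is then the limit of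
  a sequence of them. Rosenthal's dichotomy and this step are two instances of one Cantor-scheme
  argument, applied to the infinite sets of indices and to the sets of indices whose functions
  accumulate at 0.
\<close>

subsection \<open>Cantor schemes over a coideal\<close>

text \<open>The centres of finite covers by balls of radius 1/(n+1) give countably many balls, and
  these form a basis. Second countability is thus derived from compactness, the type being only a
  \<open>metric_space\<close>.\<close>

lemma compact_metric_countable_basis:
  assumes "compact (UNIV :: 'a::metric_space set)"
  obtains b :: "nat \<Rightarrow> 'a::metric_space set"
  where "\<And>n. open (b n)" "\<And>S x. open S \<Longrightarrow> x \<in> S \<Longrightarrow> \<exists>n. x \<in> b n \<and> b n \<subseteq> S"
proof -
  have "\<exists>k. finite k \<and> (UNIV::'a set) \<subseteq> (\<Union>x\<in>k. ball x (1 / real (Suc n)))" for n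
    using compact_eq_totally_bounded[of "UNIV :: 'a set"] assms
    by (metis of_nat_0_less_iff zero_less_Suc zero_less_divide_1_iff)
  then obtain K where K: "\<And>n. finite (K n)"
    "\<And>n. (UNIV::'a set) \<subseteq> (\<Union>x\<in>K n. ball x (1 / real (Suc n)))"
    by metis
  define B where "B = (\<Union>n. (\<lambda>x. ball x (1 / real (Suc n))) ` K n)"
  have cB: "countable B" unfolding B_def using K(1) by (simp add: countable_finite)
  have neB: "B \<noteq> {}" unfolding B_def using K(2)[of 0] by force
  show thesis
  proof
    show "open (from_nat_into B n)" for n
      using from_nat_into[OF neB, of n] by (auto simp: B_def)
    fix S :: "'a set" and x assume "open S" "x \<in> S"
    then obtain e where e: "e > 0" "ball x e \<subseteq> S" by (meson openE)
    obtain n where n: "1 / real (Suc n) < e / 2"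
      using e(1) nat_approx_posE[of "e/2"] by auto
    obtain p where p: "p \<in> K n" "x \<in> ball p (1 / real (Suc n))" using K(2)[of n] by blast
    have "ball p (1 / real (Suc n)) \<subseteq> ball x e"
    proof
      fix y assume y: "y \<in> ball p (1 / real (Suc n))"
      have "dist x y \<le> dist p x + dist p y" by (metis dist_commute dist_triangle)
      also have "\<dots> < e" using p(2) y n by simp
      finally show "y \<in> ball x e" by simp
    qed
    moreover have "ball p (1 / real (Suc n)) \<in> B" unfolding B_def using p(1) by blast
    ultimately show "\<exists>n. x \<in> from_nat_into B n \<and> from_nat_into B n \<subseteq> S"
      using p(2) e(2) from_nat_into_surj[OF cB] by (metis subset_trans)
  qed
qed

text \<open>Prefixes are listed last digit first, so that extending a branch is consing.\<close>

fun prefix_rev :: "(nat \<Rightarrow> bool) \<Rightarrow> nat \<Rightarrow> bool list" where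
  "prefix_rev s 0 = []"
| "prefix_rev s (Suc n) = s n # prefix_rev s n"

lemma length_prefix_rev [simp]: "length (prefix_rev s n) = n"
  by (induction n) auto

lemma prefix_rev_cong: "(\<And>j. j < n \<Longrightarrow> s j = t j) \<Longrightarrow> prefix_rev s n = prefix_rev t n"
  by (induction n) auto

text \<open>Compactness yields a point \<open>w s\<close> in all closed cells along the branch
  \<open>s\<close>. Replacing the digits of \<open>s\<close> from \<open>n\<close> on by False
  leaves the first \<open>n\<close> cells unchanged, so both points lie in one cell whose diameter
  tends to 0; this convergence later provides measurability.\<close>

lemma cantor_scheme_limit:
  fixes Q :: "nat \<Rightarrow> bool list \<Rightarrow> 'a::metric_space set" and E :: "bool \<Rightarrow> nat \<Rightarrow> 'a set"
  assumes cpt: "compact (UNIV :: 'a set)"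
    and ne: "\<And>n t. length t = n \<Longrightarrow> Q n t \<noteq> {}"
    and sub: "\<And>n t b. length t = n \<Longrightarrow> closure (Q (Suc n) (b # t)) \<subseteq> Q n t \<inter> E b n"
    and small: "\<And>n t b u v. length t = n \<Longrightarrow> u \<in> closure (Q (Suc n) (b # t))
      \<Longrightarrow> v \<in> closure (Q (Suc n) (b # t)) \<Longrightarrow> dist u v \<le> 1 / real (Suc n)"
  obtains w :: "(nat \<Rightarrow> bool) \<Rightarrow> 'a"
  where "\<And>s j. w s \<in> E (s j) j" "\<And>s. (\<lambda>n. w (\<lambda>j. j < n \<and> s j)) \<longlonglongrightarrow> w s"
proof -
  define F where "F s n = closure (Q n (prefix_rev s n))" for s n
  have "\<exists>x. \<forall>n. x \<in> F s n" for s
  proof -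
    have "F s (Suc n) \<subseteq> F s n" for n
      using sub[of "prefix_rev s n" n "s n"] closure_subset unfolding F_def by fastforce
    hence "decseq (F s)" by (simp add: decseq_Suc_iff)
    have "UNIV \<inter> \<Inter>(F s ` UNIV) \<noteq> {}"
    proof (rule compact_imp_fip_image[OF cpt])
      show "closed (F s n)" for n unfolding F_def by simp
      fix I :: "nat set" assume I: "finite I"
      \<comment> \<open>By monotonicity the last cell decides; 0 is inserted so that the maximum
        exists also for empty \<open>I\<close>.\<close>
      have "F s (Max (insert 0 I)) \<subseteq> \<Inter>(F s ` I)"
        using \<open>decseq (F s)\<close> I unfolding decseq_def by (meson INF_greatest Max_ge finite_insert insertCI)
      moreover have "F s (Max (insert 0 I)) \<noteq> {}" unfolding F_def using ne[OF length_prefix_rev] by simp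
      ultimately show "UNIV \<inter> \<Inter>(F s ` I) \<noteq> {}" by blast
    qed
    thus ?thesis by auto
  qed
  then obtain w where w: "\<And>s n. w s \<in> F s n" by metis
  show thesis
  proof
    show "w s \<in> E (s j) j" for s j
      using w[of s "Suc j"] sub[of "prefix_rev s j" j "s j"] unfolding F_def by auto
    fix s
    have close: "dist (w (\<lambda>j. j < Suc n \<and> s j)) (w s) \<le> 1 / real (Suc n)" for n
    proof -
      have "prefix_rev (\<lambda>j. j < Suc n \<and> s j) (Suc n) = prefix_rev s (Suc n)"
        by (rule prefix_rev_cong) auto
      hence "w (\<lambda>j. j < Suc n \<and> s j) \<in> F s (Suc n)"
        using w[of "\<lambda>j. j < Suc n \<and> s j" "Suc n"] unfolding F_def by simp
      thus ?thesis using small[of "prefix_rev s n" n _ "s n"] w[of s "Suc n"] unfolding F_def by auto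
    qed
    have lim: "(\<lambda>n. 1 / real (Suc n)) \<longlonglongrightarrow> 0"
      using LIMSEQ_inverse_real_of_nat by (simp add: inverse_eq_divide)
    have "(\<lambda>n. dist (w (\<lambda>j. j < Suc n \<and> s j)) (w s)) \<longlonglongrightarrow> 0"
      by (rule Lim_null_comparison[OF _ lim]) (use close in \<open>simp del: of_nat_Suc\<close>)
    hence "(\<lambda>n. w (\<lambda>j. j < Suc n \<and> s j)) \<longlonglongrightarrow> w s" by (simp only: tendsto_dist_iff[of _ "w s"])
    thus "(\<lambda>n. w (\<lambda>j. j < n \<and> s j)) \<longlonglongrightarrow> w s" by (rule LIMSEQ_imp_Suc)
  qed
qed

text \<open>
  Call an open set bad if no positive set of indices is good on all of it. Deciding all basic open sets
  along a decreasing sequence of positive sets, and diagonalising, yields one positive set for which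
  the points that are not good have only bad neighbourhoods; \<open>split\<close> then feeds the scheme.
\<close>

proposition cantor_scheme_dichotomy:
  fixes pos :: "'i set \<Rightarrow> bool" and good :: "'e::countable \<Rightarrow> 'i set \<Rightarrow> 'a::metric_space \<Rightarrow> bool"
    and E :: "'e \<Rightarrow> bool \<Rightarrow> 'i \<Rightarrow> 'a set"
  assumes cpt: "compact (UNIV :: 'a set)"
    and pos_UNIV: "pos UNIV"
    and pos_nonempty: "\<And>A. pos A \<Longrightarrow> A \<noteq> {}"
    and pos_diff: "\<And>A F. pos A \<Longrightarrow> finite F \<Longrightarrow> pos (A - F)"
    and pos_diag: "\<And>A :: nat \<Rightarrow> 'i set. (\<And>n. pos (A n)) \<Longrightarrow> decseq A \<Longrightarrow>
      \<exists>B. pos B \<and> (\<forall>n. finite (B - A n))"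
    and good_mono: "\<And>e A B x. good e A x \<Longrightarrow> finite (B - A) \<Longrightarrow> good e B x"
    and open_E: "\<And>e b i. open (E e b i)"
    and split: "\<And>e A S. pos A \<Longrightarrow> S \<noteq> {} \<Longrightarrow>
      (\<And>B. pos B \<Longrightarrow> B \<subseteq> A \<Longrightarrow> \<exists>x\<in>S. \<not> good e B x) \<Longrightarrow>
      \<exists>B\<subseteq>A. pos B \<and> (\<forall>i\<in>B. \<forall>b. S \<inter> E e b i \<noteq> {})"
  obtains (good) A where "pos A" "\<And>e x. good e A x"
  | (scheme) e a w where "\<And>s j. w s \<in> E e (s j) (a j)"
      "\<And>s. (\<lambda>n. w (\<lambda>j. j < n \<and> s j)) \<longlonglongrightarrow> w s"
proof -
  obtain U :: "nat \<Rightarrow> 'a set" where U: "\<And>n. open (U n)"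
    "\<And>S x. open S \<Longrightarrow> x \<in> S \<Longrightarrow> \<exists>n. x \<in> U n \<and> U n \<subseteq> S"
    using compact_metric_countable_basis[OF cpt] by metis
  \<comment> \<open>The number \<open>k\<close> codes a pair of a basic open set and a parameter, so
    that all decisions about \<open>good\<close> form one sequence.\<close>
  define P where "P k B \<longleftrightarrow> (\<forall>x\<in>U (fst (prod_decode k)). good (from_nat (snd (prod_decode k))) B x)"
    for k B
  have P_mono: "P k B" if "P k A" "finite (B - A)" for k A B
    using that good_mono unfolding P_def by blast
  \<comment> \<open>Stage \<open>k\<close> passes to a positive subset satisfying \<open>P k\<close>
    if there is one; otherwise all positive subsets, now and later, fail it.\<close>
  have "\<exists>A. \<forall>k. pos (A k) \<and> (A (Suc k) \<subseteq> A k \<and>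
     (P k (A (Suc k)) \<or> (\<forall>B\<subseteq>A k. pos B \<longrightarrow> \<not> P k B)))"
  proof (rule dependent_nat_choice)
    show "\<exists>x. pos x" using pos_UNIV by blast
    show "\<exists>y. pos y \<and> y \<subseteq> x \<and> (P n y \<or> (\<forall>B\<subseteq>x. pos B \<longrightarrow> \<not> P n B))" if "pos x" for x n
      using that by blast
  qed
  then obtain A where A: "\<And>k. pos (A k)" "\<And>k. A (Suc k) \<subseteq> A k"
    "\<And>k. P k (A (Suc k)) \<or> (\<forall>B\<subseteq>A k. pos B \<longrightarrow> \<not> P k B)" by metis
  have "decseq A" using A(2) by (simp add: decseq_Suc_iff)
  then obtain C where C: "pos C" "\<And>n. finite (C - A n)" using pos_diag A(1) by metis
  \<comment> \<open>\<open>C\<close> is contained in \<open>A k\<close> only up to a finite set;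
    \<open>pos_diff\<close> and \<open>good_mono\<close> absorb the difference.\<close>
  have decided: "P k C \<or> (\<forall>B\<subseteq>C. pos B \<longrightarrow> \<not> P k B)" for k
  proof (cases "P k (A (Suc k))")
    case True then show ?thesis using P_mono C(2) by blast
  next
    case False
    have "\<not> P k B" if B: "B \<subseteq> C" "pos B" for B
    proof
      assume "P k B"
      have *: "B - (C - A k) \<subseteq> A k" using B(1) by blast
      have "pos (B - (C - A k))" using pos_diff B(2) C(2) by blast
      hence "\<not> P k (B - (C - A k))" using A(3)[of k] False * by blast
      thus False using P_mono[OF \<open>P k B\<close>, of "B - (C - A k)"]
        by (metis Diff_eq_empty_iff Diff_subset finite.emptyI)
    qed
    thus ?thesis by blast
  qed
  \<comment> \<open>The union of the basic sets on which \<open>C\<close> was decided to be good.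
    Every neighbourhood of a point outside is bad: each positive subset of \<open>C\<close> fails
    somewhere in it.\<close>
  define G where "G e = {x. \<exists>n. x \<in> U n \<and> P (prod_encode (n, to_nat e)) C}" for e :: 'e
  have good_G: "good e C x" if "x \<in> G e" for e x
    using that unfolding G_def P_def by auto
  show thesis
  proof (cases "\<forall>e. G e = UNIV")
    case True
    then show thesis using good C(1) good_G by blast
  next
    case False
    then obtain e where e: "- G e \<noteq> {}" by blast
    have bad: "\<exists>x\<in>S \<inter> - G e. \<not> good e B x"
      if S: "open S" "S \<inter> - G e \<noteq> {}" and B: "pos B" "B \<subseteq> C" for S B
    proof -
      obtain y where y: "y \<in> S" "y \<notin> G e" using S(2) by blast
      obtain n where n: "y \<in> U n" "U n \<subseteq> S" using U(2)[OF S(1) y(1)] by blast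
      have "\<not> P (prod_encode (n, to_nat e)) C" using y n unfolding G_def by blast
      hence "\<not> P (prod_encode (n, to_nat e)) B" using decided B by blast
      then obtain x where x: "x \<in> U n" "\<not> good e B x" unfolding P_def by auto
      have "x \<notin> G e" using good_G x(2) good_mono[of e C x B] B(2)
        by (metis Diff_eq_empty_iff finite.emptyI)
      thus ?thesis using x n by blast
    qed
    \<comment> \<open>The finitely many cells of a level are treated in turn, shrinking
      \<open>B\<close> each time, so that a single index splits all of them.\<close>
    have step: "\<exists>B\<subseteq>C. pos B \<and> (\<forall>t\<in>T. \<forall>i\<in>B. \<forall>b. Q t \<inter> - G e \<inter> E e b i \<noteq> {})"
      if "finite T" "\<And>t. t \<in> T \<Longrightarrow> open (Q t) \<and> Q t \<inter> - G e \<noteq> {}"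
      for T and Q :: "bool list \<Rightarrow> 'a set"
      using that
    proof (induction T rule: finite_induct)
      case empty then show ?case using C(1) by blast
    next
      case (insert t T)
      then obtain B where B: "B \<subseteq> C" "pos B" "\<forall>t\<in>T. \<forall>i\<in>B. \<forall>b. Q t \<inter> - G e \<inter> E e b i \<noteq> {}"
        by auto
      have "\<exists>B'\<subseteq>B. pos B' \<and> (\<forall>i\<in>B'. \<forall>b. Q t \<inter> - G e \<inter> E e b i \<noteq> {})"
        using insert.prems[of t] B bad[of "Q t"] by (intro split) auto
      then obtain B' where "B' \<subseteq> B" "pos B'" "\<forall>i\<in>B'. \<forall>b. Q t \<inter> - G e \<inter> E e b i \<noteq> {}" by blast
      then show ?case using B by (intro exI[of _ B']) auto
    qed
    \<comment> \<open>The state \<open>z\<close> consists of the index chosen last and the current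
      cells. Cells keep meeting the complement of \<open>G e\<close>, which is what allows
      \<open>step\<close> to split them again.\<close>
    define I where "I n (z :: 'i \<times> (bool list \<Rightarrow> 'a set)) \<longleftrightarrow>
      (\<forall>t. length t = n \<longrightarrow> open (snd z t) \<and> snd z t \<inter> - G e \<noteq> {})" for n z
    define J where "J n (z :: 'i \<times> (bool list \<Rightarrow> 'a set)) z' \<longleftrightarrow>
      (\<forall>t b. length t = n \<longrightarrow> closure (snd z' (b # t)) \<subseteq> snd z t \<inter> E e b (fst z') \<and>
        (\<forall>u\<in>closure (snd z' (b # t)). \<forall>v\<in>closure (snd z' (b # t)). dist u v \<le> 1 / real (Suc n)))"
      for n z z'
    have "\<exists>z. \<forall>n. I n (z n) \<and> J n (z n) (z (Suc n))"
    proof (rule dependent_nat_choice)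
      \<comment> \<open>The initial index is a dummy: only the indices from stage 1 on enter the
        scheme.\<close>
      show "\<exists>x. I 0 x" unfolding I_def using e by (intro exI[of _ "(undefined, \<lambda>_. UNIV)"]) auto
      fix z n assume z: "I n z"
      have "finite {t :: bool list. length t = n}"
        using finite_lists_length_eq[of "UNIV :: bool set" n] by simp
      then obtain B where B: "pos B"
        "\<forall>t\<in>{t. length t = n}. \<forall>i\<in>B. \<forall>b. snd z t \<inter> - G e \<inter> E e b i \<noteq> {}"
        using step[of "{t. length t = n}" "snd z"] z unfolding I_def by auto
      obtain i where "i \<in> B" using pos_nonempty B(1) by blast
      hence i: "snd z t \<inter> - G e \<inter> E e b i \<noteq> {}" if "length t = n" for t b
        using B(2) that by blast
      define R where "R b t V \<longleftrightarrow> open V \<and> V \<inter> - G e \<noteq> {} \<and> closure V \<subseteq> snd z t \<inter> E e b i \<and>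
          (\<forall>u\<in>closure V. \<forall>v\<in>closure V. dist u v \<le> 1 / real (Suc n))" for b t V
      have ex: "\<exists>V. R b t V" if t: "length t = n" for t b
      proof -
        obtain x where x: "x \<in> snd z t \<inter> E e b i" "x \<notin> G e" using i[OF t] by blast
        have "open (snd z t \<inter> E e b i)" using z t open_E unfolding I_def by blast
        then obtain d where d: "d > 0" "cball x d \<subseteq> snd z t \<inter> E e b i"
          using x(1) open_contains_cball by blast
        define c where "c = 1 / real (Suc n)"
        have "c > 0" unfolding c_def by simp
        \<comment> \<open>Radius at most \<open>c / 2\<close> bounds the diameter by
          \<open>c\<close>; radius at most \<open>d\<close> keeps the closed ball inside the parent
          cell and \<open>E e b i\<close>.\<close>
        define d' where "d' = min d (c / 2)"
        have d': "d' > 0" "d' \<le> d" "d' \<le> c / 2" using d(1) \<open>c > 0\<close> unfolding d'_def by auto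
        have cl: "closure (ball x d') \<subseteq> cball x d'"
          by (rule closure_minimal) auto
        have "dist u v \<le> c" if "u \<in> cball x d'" "v \<in> cball x d'" for u v
          using that d'(3) dist_triangle3[of u v x] unfolding mem_cball by linarith
        hence "\<forall>u\<in>closure (ball x d'). \<forall>v\<in>closure (ball x d'). dist u v \<le> 1 / real (Suc n)"
          using cl unfolding c_def by blast
        moreover have "cball x d' \<subseteq> cball x d" using d'(2) by auto
        hence "closure (ball x d') \<subseteq> snd z t \<inter> E e b i" using cl d(2) by blast
        moreover have "x \<in> ball x d'" using d'(1) by simp
        hence "ball x d' \<inter> - G e \<noteq> {}" using x(2) by blast
        ultimately show ?thesis unfolding R_def using open_ball by blast
      qed
      define V where "V b t = (SOME V. R b t V)" for b t
      have V: "R b t (V b t)" if "length t = n" for t b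
        unfolding V_def using someI_ex[OF ex[OF that]] .
      show "\<exists>z'. I (Suc n) z' \<and> J n z z'"
      proof (intro exI conjI)
        show "I (Suc n) (i, \<lambda>t. V (hd t) (tl t))" unfolding I_def using V[unfolded R_def] by (auto simp: length_Suc_conv)
        show "J n z (i, \<lambda>t. V (hd t) (tl t))" unfolding J_def using V[unfolded R_def] by auto
      qed
    qed
    then obtain z where z: "\<And>n. I n (z n)" "\<And>n. J n (z n) (z (Suc n))" by metis
    obtain w where "\<And>s j. w s \<in> E e (s j) (fst (z (Suc j)))"
      "\<And>s. (\<lambda>n. w (\<lambda>j. j < n \<and> s j)) \<longlonglongrightarrow> w s"
    proof (rule cantor_scheme_limit[OF cpt, of "\<lambda>n. snd (z n)" "\<lambda>b j. E e b (fst (z (Suc j)))"])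
      show "snd (z n) t \<noteq> {}" if "length t = n" for n t using z(1)[of n] that unfolding I_def by blast
      show "closure (snd (z (Suc n)) (b # t)) \<subseteq> snd (z n) t \<inter> E e b (fst (z (Suc n)))"
        if "length t = n" for n t b using z(2)[of n] that unfolding J_def by blast
      show "dist u v \<le> 1 / real (Suc n)" if "length t = n" "u \<in> closure (snd (z (Suc n)) (b # t))"
        "v \<in> closure (snd (z (Suc n)) (b # t))" for n t b u v
        using z(2)[of n] that unfolding J_def by blast
    qed blast
    thus thesis by (rule scheme)
  qed
qed

subsection \<open>Rosenthal's dichotomy\<close>

lemma infinite_strict_mono_image:
  fixes r :: "nat \<Rightarrow> nat"
  assumes "strict_mono r" "eventually (\<lambda>n. P (r n)) sequentially"
  shows "infinite {n. P n}"
proof -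
  obtain N where "\<forall>n\<ge>N. P (r n)" using assms(2) by (auto simp: eventually_sequentially)
  hence "r ` {N..} \<subseteq> {n. P n}" by auto
  moreover have "infinite (r ` {N..})"
    using assms(1) by (meson finite_imageD infinite_Ici strict_mono_imp_inj_on inj_on_subset subset_UNIV)
  ultimately show ?thesis using finite_subset by blast
qed

text \<open>Let \<open>l\<close> be a cluster point. If \<open>l < p < q < c\<close> with rational
  \<open>p\<close> and \<open>q\<close>, infinitely many terms are below \<open>p\<close>, hence
  only finitely many above \<open>q\<close>; lower bounds are symmetric. Rational levels keep the
  parameters of the scheme countable.\<close>

lemma convergent_if_no_oscillation:
  fixes X :: "nat \<Rightarrow> real"
  assumes "bounded (range X)"
    and osc: "\<And>p q :: rat. p < q \<Longrightarrow>
      finite {n. X n < of_rat p} \<or> finite {n. X n > of_rat q}"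
  shows "convergent X"
proof -
  obtain l r where r: "strict_mono r" "(X \<circ> r) \<longlonglongrightarrow> l"
    using bounded_imp_convergent_subsequence[OF assms(1)] by blast
  have "X \<longlonglongrightarrow> l"
  proof (rule order_tendstoI)
    fix c assume "l < c"
    obtain q :: rat where q: "l < of_rat q" "of_rat q < c" using of_rat_dense \<open>l < c\<close> by blast
    obtain p :: rat where p: "l < of_rat p" "real_of_rat p < of_rat q" using of_rat_dense q(1) by blast
    have "infinite {n. X n < of_rat p}"
      using order_tendstoD(2)[OF r(2) p(1)] r(1) by (intro infinite_strict_mono_image) auto
    hence "finite {n. X n > of_rat q}" using osc p(2) by (auto simp: of_rat_less)
    hence "eventually (\<lambda>n. \<not> X n > of_rat q) sequentially"
      by (simp add: cofinite_eq_sequentially[symmetric] eventually_cofinite)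
    thus "eventually (\<lambda>n. X n < c) sequentially" by eventually_elim (use q(2) in auto)
  next
    fix c assume "c < l"
    obtain p :: rat where p: "c < of_rat p" "of_rat p < l" using of_rat_dense \<open>c < l\<close> by blast
    obtain q :: rat where q: "real_of_rat p < of_rat q" "of_rat q < l" using of_rat_dense p(2) by blast
    have "infinite {n. X n > of_rat q}"
      using order_tendstoD(1)[OF r(2) q(2)] r(1) by (intro infinite_strict_mono_image) auto
    hence "finite {n. X n < of_rat p}" using osc q(1) by (auto simp: of_rat_less)
    hence "eventually (\<lambda>n. \<not> X n < of_rat p) sequentially"
      by (simp add: cofinite_eq_sequentially[symmetric] eventually_cofinite)
    thus "eventually (\<lambda>n. c < X n) sequentially" by eventually_elim (use p(1) in auto)
  qed
  thus ?thesis by (rule convergentI)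
qed

text \<open>Diagonal choice: an increasing sequence with \<open>f n\<close> in \<open>A n\<close>
  can leave \<open>A n\<close> only at its first \<open>n\<close> places.\<close>

lemma infinite_decseq_pseudo_intersection:
  fixes A :: "nat \<Rightarrow> nat set"
  assumes inf: "\<And>n. infinite (A n)" and dec: "decseq A"
  shows "\<exists>B. infinite B \<and> (\<forall>n. finite (B - A n))"
proof -
  have "\<exists>f. \<forall>n. f n \<in> A n \<and> f n < f (Suc n)"
  proof (rule dependent_nat_choice)
    show "\<exists>x. x \<in> A 0" using inf[of 0] by (metis ex_in_conv finite.emptyI)
    show "\<exists>y. y \<in> A (Suc n) \<and> x < y" for x n
      using inf[of "Suc n"] by (metis infinite_nat_iff_unbounded)
  qed
  then obtain f where f: "\<And>n. f n \<in> A n" "\<And>n. f n < f (Suc n)" by blast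
  have sm: "strict_mono f" using f(2) by (simp add: strict_mono_Suc_iff)
  show ?thesis
  proof (intro exI conjI allI)
    show "infinite (range f)" using sm strict_mono_imp_inj_on range_inj_infinite by blast
    fix n
    have "f m \<in> A n" if "n \<le> m" for m using f(1) decseqD[OF dec that] by blast
    hence "range f - A n \<subseteq> f ` {..<n}" by (auto simp: not_less[symmetric])
    thus "finite (range f - A n)" using finite_surj by blast
  qed
qed

text \<open>If every pattern \<open>s\<close> is realised at some point, the pairs of sets
  \<open>f j < p\<close> and \<open>f j > q\<close> are Boolean independent in the sense of
  Rosenthal.\<close>

definition alternating :: "(nat \<Rightarrow> 'a::topological_space \<Rightarrow>\<^sub>C real) \<Rightarrow> real \<Rightarrow> real \<Rightarrow> (nat \<Rightarrow> bool) \<Rightarrow> 'a \<Rightarrow> bool"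
  where "alternating f p q s x \<longleftrightarrow> (\<forall>j. if s j then f j x < p else q < f j x)"

text \<open>The scheme argument with the infinite index sets as positive ones; an index set is good
  at a point if its values there do not oscillate across a given pair of rationals.\<close>

proposition rosenthal_dichotomy:
  fixes f :: "nat \<Rightarrow> 'a::metric_space \<Rightarrow>\<^sub>C real"
  assumes cpt: "compact (UNIV :: 'a set)" and bdd: "\<And>n. norm (f n) \<le> K"
  obtains (convergent) r :: "nat \<Rightarrow> nat" where "strict_mono r" "\<And>x. convergent (\<lambda>n. f (r n) x)"
  | (scheme) a :: "nat \<Rightarrow> nat" and p q w where "p < q" "\<And>s. alternating (\<lambda>j. f (a j)) p q s (w s)"
      "\<And>s. (\<lambda>n. w (\<lambda>j. j < n \<and> s j)) \<longlonglongrightarrow> w s"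
proof -
  \<comment> \<open>Pairs in the wrong order are trivially good; the order condition inside
    \<open>E\<close> hands \<open>p < q\<close> back when a scheme arises.\<close>
  define gd where "gd e A x \<longleftrightarrow> fst e < snd e \<longrightarrow>
      finite {n\<in>A. f n x < of_rat (fst e)} \<or> finite {n\<in>A. f n x > of_rat (snd e)}"
    for e :: "rat \<times> rat" and A x
  define E where "E e b n = (if b then {x. f n x < of_rat (fst e) \<and> fst e < snd e}
     else {x. of_rat (snd e) < f n x \<and> fst e < snd e})" for e :: "rat \<times> rat" and b n
  show thesis
  proof (rule cantor_scheme_dichotomy[of "\<lambda>A :: nat set. infinite A" gd E])
    show "\<exists>B. infinite B \<and> (\<forall>n. finite (B - A n))"
      if "\<And>n. infinite (A n)" "decseq A" for A :: "nat \<Rightarrow> nat set"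
      using infinite_decseq_pseudo_intersection that by blast
    show "gd e B x" if "gd e A x" "finite (B - A)" for e A B x
    proof -
      have "finite {n\<in>B. P n}" if "finite {n\<in>A. P n}" for P
      proof (rule finite_subset)
        show "{n\<in>B. P n} \<subseteq> {n\<in>A. P n} \<union> (B - A)" by blast
      qed (use that \<open>finite (B - A)\<close> in simp)
      from this[of "\<lambda>n. f n x < of_rat (fst e)"] this[of "\<lambda>n. f n x > of_rat (snd e)"]
      show ?thesis using that(1) unfolding gd_def by blast
    qed
    show "open (E e b i)" for e b i
      unfolding E_def by (auto intro!: open_Collect_conj open_Collect_less)
    show "\<exists>B\<subseteq>A. infinite B \<and> (\<forall>i\<in>B. \<forall>b. S \<inter> E e b i \<noteq> {})"
      if A: "infinite A" and S: "\<And>B. infinite B \<Longrightarrow> B \<subseteq> A \<Longrightarrow> \<exists>x\<in>S. \<not> gd e B x" for e A S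
    proof -
      \<comment> \<open>Badness is applied twice: thin out to the indices that are low at
        \<open>x\<close>, then find a point \<open>y\<close> where infinitely many of these are
        high. The remaining indices take both sides on \<open>S\<close>.\<close>
      obtain x where x: "x \<in> S" "fst e < snd e" "infinite {n\<in>A. f n x < of_rat (fst e)}"
        using S[OF A] unfolding gd_def by blast
      obtain y where y: "y \<in> S" "infinite {n\<in>{n\<in>A. f n x < of_rat (fst e)}. f n y > of_rat (snd e)}"
        using S[OF x(3)] unfolding gd_def by blast
      show ?thesis
        using x(1,2) y by (intro exI[of _ "{n\<in>{n\<in>A. f n x < of_rat (fst e)}. f n y > of_rat (snd e)}"])
         (auto simp: E_def)
    qed
  next
    fix A assume A: "infinite A" "\<And>e x. gd e A x"
    define r where "r = enumerate A"
    have r: "strict_mono r" "range r = A"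
      unfolding r_def using A(1) by (auto simp: strict_mono_enumerate range_enumerate)
    have "convergent (\<lambda>n. f (r n) x)" for x
    proof (rule convergent_if_no_oscillation)
      show "bounded (range (\<lambda>n. f (r n) x))"
        using order_trans[OF norm_bounded bdd] by (intro boundedI[of _ K]) auto
      fix p q :: rat assume pq: "p < q"
      have "finite {n. P (r n)}" if "finite {n\<in>A. P n}" for P
      proof -
        have "r ` {n. P (r n)} \<subseteq> {n\<in>A. P n}" using r(2) by auto
        thus ?thesis using that r(1)
          by (meson finite_imageD finite_subset inj_on_subset strict_mono_imp_inj_on subset_UNIV)
      qed
      from this[of "\<lambda>n. f n x < of_rat p"] this[of "\<lambda>n. f n x > of_rat q"]
      show "finite {n. f (r n) x < of_rat p} \<or> finite {n. f (r n) x > of_rat q}"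
        using A(2)[of "(p,q)" x] pq unfolding gd_def by auto
    qed
    thus thesis using convergent r(1) by blast
  next
    fix e a w assume aw: "\<And>s j. w s \<in> E e (s j) (a j)" "\<And>s. (\<lambda>n. w (\<lambda>j. j < n \<and> s j)) \<longlonglongrightarrow> w s"
    have "of_rat (fst e) < (of_rat (snd e) :: real)"
      using aw(1)[of "\<lambda>_. True" 0] by (simp add: E_def of_rat_less)
    moreover have "alternating (\<lambda>j. f (a j)) (of_rat (fst e)) (of_rat (snd e)) s (w s)" for s
      unfolding alternating_def
    proof
      fix j show "if s j then f (a j) (w s) < of_rat (fst e) else of_rat (snd e) < f (a j) (w s)"
        using aw(1)[of s j] by (simp add: E_def split: if_splits)
    qed
    ultimately show thesis using scheme aw(2) by blast
  qed (use cpt in auto)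
qed

section \<open>Independence in an orbit contradicts tameness\<close>

lemma alternating_norm_ge:
  assumes alt: "\<And>s. \<exists>x. alternating f p q s x" and "p < q"
  shows "norm (\<Sum>k<N. a k *\<^sub>R f k) \<ge> (q - p) / 2 * (\<Sum>k<N. \<bar>a k\<bar>)"
proof -
  let ?z = "\<Sum>k<N. a k *\<^sub>R f k"
  \<comment> \<open>The sign pattern of the coefficients and its opposite: each term contributes at
    least \<open>(q - p) * \<bar>a k\<bar>\<close> to the difference of the values at
    \<open>x\<close> and \<open>y\<close>, which is at most twice the norm.\<close>
  obtain x y where x: "alternating f p q (\<lambda>k. a k < 0) x" and y: "alternating f p q (\<lambda>k. a k \<ge> 0) y"
    using alt by blast
  have ev: "apply_bcontfun ?z t = (\<Sum>k<N. a k * f k t)" for t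
    by (induction N) auto
  have "(q - p) * (\<Sum>k<N. \<bar>a k\<bar>) \<le> (\<Sum>k<N. a k * f k x - a k * f k y)"
    unfolding sum_distrib_left
  proof (rule sum_mono)
    fix k
    have "f k x - f k y \<ge> q - p" if "a k \<ge> 0"
      using x[unfolded alternating_def, THEN spec, of k] y[unfolded alternating_def, THEN spec, of k] that
      by simp
    moreover have "f k y - f k x \<ge> q - p" if "a k < 0"
      using x[unfolded alternating_def, THEN spec, of k] y[unfolded alternating_def, THEN spec, of k] that
      by simp
    ultimately show "(q - p) * \<bar>a k\<bar> \<le> a k * f k x - a k * f k y"
      using mult_left_mono[of "q - p" "f k x - f k y" "a k"] mult_left_mono[of "q - p" "f k y - f k x" "- a k"]
      by (cases "a k \<ge> 0") (auto simp: algebra_simps)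
  qed
  also have "\<dots> = ?z x - ?z y" by (simp add: ev sum_subtractf)
  also have "\<dots> \<le> 2 * norm ?z"
    using norm_bounded[of ?z x] norm_bounded[of ?z y] by simp
  finally show ?thesis by simp
qed

lemma alternating_inj:
  assumes "\<And>s. \<exists>x. alternating (\<lambda>j. f (a j)) p q s x" "p < q"
  shows "inj a"
proof (rule injI, rule ccontr)
  fix i j assume "a i = a j" "i \<noteq> j"
  obtain x where x: "alternating (\<lambda>j. f (a j)) p q (\<lambda>k. k = i) x" using assms(1) by blast
  have "f (a i) x < p" "q < f (a j) x"
    using x \<open>i \<noteq> j\<close> unfolding alternating_def by metis+
  thus False using \<open>a i = a j\<close> assms(2) by simp
qed

text \<open>The pattern is transported along \<open>t\<close>; places outside the range of
  \<open>t\<close> carry arbitrary digits.\<close>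

lemma alternating_subseq:
  assumes "\<And>s. \<exists>x. alternating f p q s x" "inj t"
  shows "\<exists>x. alternating (\<lambda>j. f (t j)) p q s x"
proof -
  obtain x where "alternating f p q (\<lambda>i. s (inv t i)) x" using assms(1) by blast
  hence "alternating (\<lambda>j. f (t j)) p q s x"
    using assms(2) unfolding alternating_def by (metis inv_f_f)
  thus ?thesis by blast
qed

lemma inj_nat_strict_mono_subseq:
  fixes a :: "nat \<Rightarrow> nat" assumes "inj a"
  obtains t :: "nat \<Rightarrow> nat" where "strict_mono t" "strict_mono (a \<circ> t)"
proof -
  have "\<exists>m>t. a m > a t" for t
  proof (rule ccontr)
    assume "\<not> ?thesis"
    hence "\<forall>m>t. a m \<le> a t" by (meson not_less)
    hence "a ` {t<..} \<subseteq> {..a t}" by auto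
    hence "finite (a ` {t<..})" by (rule finite_subset) simp
    hence "finite {t<..}" using assms by (meson finite_imageD inj_on_subset subset_UNIV)
    thus False by (simp add: infinite_Ioi)
  qed
  hence "\<exists>t. \<forall>n::nat. True \<and> (t n < t (Suc n) \<and> a (t n) < a (t (Suc n)))"
    by (intro dependent_nat_choice) auto
  then obtain t where "\<And>n. t n < t (Suc n)" "\<And>n. a (t n) < a (t (Suc n))" by blast
  thus thesis using that[of t] by (simp add: strict_mono_Suc_iff)
qed

text \<open>Independence bounds the norms of normalised combinations below by
  \<open>(q - p) / 2\<close>, against the infimum 0. As tameness speaks of strictly increasing
  exponents, the injective \<open>a\<close> is first thinned out.\<close>

lemma tame_not_alternating:
  assumes "tame \<phi>" "p < q"
  shows "\<exists>s. \<forall>x. \<not> alternating (\<lambda>j. blinfun_apply (op_pow (koopman \<phi>) (a j)) f) p q s x"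
proof (rule ccontr)
  assume "\<not> ?thesis"
  hence alt: "\<And>s. \<exists>x. alternating (\<lambda>j. blinfun_apply (op_pow (koopman \<phi>) (a j)) f) p q s x" by blast
  have "inj a" using alternating_inj[of "\<lambda>k. blinfun_apply (op_pow (koopman \<phi>) k) f" a] alt assms(2) by blast
  then obtain t :: "nat \<Rightarrow> nat" where t: "strict_mono t" "strict_mono (a \<circ> t)" by (rule inj_nat_strict_mono_subseq)
  define n where "n = a \<circ> t"
  define g where "g k = blinfun_apply (op_pow (koopman \<phi>) (n k)) f" for k :: nat
  have alt': "\<exists>x. alternating g p q s x" for s
    using alternating_subseq[OF alt strict_mono_imp_inj_on[OF t(1)]] unfolding g_def n_def comp_def .
  define S where "S = {(a::nat \<Rightarrow> real, N::nat). (\<Sum>k<N. \<bar>a k\<bar>) = 1}"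
  have "(\<lambda>_. 1, 1) \<in> S" unfolding S_def by simp
  hence "S \<noteq> {}" by blast
  hence "(q - p) / 2 \<le> (INF aN \<in> S. norm (\<Sum>k<snd aN. fst aN k *\<^sub>R g k))"
  proof (rule cINF_greatest)
    show "(q - p) / 2 \<le> norm (\<Sum>k<snd aN. fst aN k *\<^sub>R g k)" if "aN \<in> S" for aN
      using that alternating_norm_ge[OF alt' assms(2), where a="fst aN" and N="snd aN"]
      unfolding S_def by (cases aN) simp
  qed
  also have "\<dots> = 0" using assms(1) t(2) unfolding tame_def g_def n_def S_def by blast
  finally show False using assms(2) by simp
qed

subsection \<open>Convex hulls\<close>

text \<open>The hull of points within \<open>d\<close> of finitely many \<open>f q\<close> stays
  within \<open>d\<close> of the hull of these, which is norm compact. Two terms with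
  \<open>d\<close>-close approximants are at distance at most \<open>d + d + d\<close>.\<close>

lemma seminorm_totally_bounded_convex_hull:
  fixes L :: "'b::real_normed_vector \<Rightarrow> real" and f y :: "nat \<Rightarrow> 'b"
  assumes tri: "\<And>g h. L (g + h) \<le> L g + L h" and scale: "\<And>c g. L (c *\<^sub>R g) = \<bar>c\<bar> * L g"
    and le_norm: "\<And>g. L g \<le> norm g"
    and Q: "finite Q" "\<And>k. \<exists>q\<in>Q. L (f k - f q) < d"
    and y: "\<And>n. y n \<in> convex hull (range f)"
  obtains m n where "m \<noteq> n" "L (y m - y n) \<le> 3 * d"
proof -
  define D where "D = {g. \<exists>z\<in>convex hull (f ` Q). L (g - z) \<le> d}"
  have "convex D"
  proof (rule convexI)
    fix g h u v :: _ assume "g \<in> D" "h \<in> D" and uv: "0 \<le> u" "0 \<le> v" "u + v = (1::real)"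
    then obtain z w where z: "z \<in> convex hull (f ` Q)" "L (g - z) \<le> d"
      and w: "w \<in> convex hull (f ` Q)" "L (h - w) \<le> d" unfolding D_def by blast
    have "(u *\<^sub>R g + v *\<^sub>R h) - (u *\<^sub>R z + v *\<^sub>R w) = u *\<^sub>R (g - z) + v *\<^sub>R (h - w)"
      by (simp add: algebra_simps)
    hence "L ((u *\<^sub>R g + v *\<^sub>R h) - (u *\<^sub>R z + v *\<^sub>R w)) \<le> u * L (g - z) + v * L (h - w)"
      using tri[of "u *\<^sub>R (g - z)" "v *\<^sub>R (h - w)"] uv by (simp add: scale)
    also have "\<dots> \<le> d" using convex_bound_le[OF z(2) w(2) uv] by simp
    finally show "u *\<^sub>R g + v *\<^sub>R h \<in> D"
      using convexD[OF convex_convex_hull z(1) w(1) uv] unfolding D_def by blast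
  qed
  moreover have "f k \<in> D" for k
  proof -
    obtain q where "q \<in> Q" "L (f k - f q) < d" using Q(2) by blast
    moreover have "f q \<in> convex hull (f ` Q)" using calculation(1) by (simp add: hull_inc)
    ultimately show ?thesis unfolding D_def by (auto intro: less_imp_le)
  qed
  hence "range f \<subseteq> D" by blast
  ultimately have "convex hull (range f) \<subseteq> D" by (simp add: hull_minimal)
  hence "\<forall>n. \<exists>z. z \<in> convex hull (f ` Q) \<and> L (y n - z) \<le> d" using y unfolding D_def by blast
  then obtain z where z: "\<And>n. z n \<in> convex hull (f ` Q)" "\<And>n. L (y n - z n) \<le> d" by metis
  have "seq_compact (convex hull (f ` Q))"
    using Q(1) by (intro compact_imp_seq_compact finite_imp_compact_convex_hull) auto
  then obtain r l where r: "strict_mono (r :: nat \<Rightarrow> nat)" "(z \<circ> r) \<longlonglongrightarrow> l"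
    using z(1) unfolding seq_compact_def by metis
  have "d > 0"
  proof -
    obtain q where "L (f 0 - f q) < d" using Q(2) by blast
    moreover have "L 0 = 0" using scale[of 0 0] by simp
    hence "0 \<le> L g" for g using tri[of g "- g"] scale[of "-1" g] by simp
    ultimately show ?thesis by (metis le_less_trans)
  qed
  then obtain N where N: "\<And>m n. m \<ge> N \<Longrightarrow> n \<ge> N \<Longrightarrow> dist ((z \<circ> r) m) ((z \<circ> r) n) < d"
    using LIMSEQ_imp_Cauchy[OF r(2)] unfolding Cauchy_def by metis
  let ?m = "r N" and ?n = "r (Suc N)"
  have "L (z ?m - z ?n) \<le> d" using N[of N "Suc N"] le_norm[of "z ?m - z ?n"] by (simp add: dist_norm)
  moreover have "L (z ?n - y ?n) \<le> d" using scale[of "-1" "y ?n - z ?n"] z(2)[of ?n] by simp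
  ultimately have "L (y ?m - y ?n) \<le> 3 * d"
    using tri[of "y ?m - z ?m" "z ?m - y ?n"] tri[of "z ?m - z ?n" "z ?n - y ?n"] z(2)[of ?m] by simp
  moreover have "?m \<noteq> ?n" using r(1) by (metis lessI less_irrefl strict_monoD)
  ultimately show thesis using that by blast
qed

text \<open>Greedy choice: each new element keeps distance at least \<open>e\<close> from the finite
  set \<open>S n\<close> of those chosen before.\<close>

lemma not_totally_bounded_separated_seq:
  fixes d :: "'k \<Rightarrow> 'k \<Rightarrow> real"
  assumes "\<And>Q. finite Q \<Longrightarrow> \<exists>k. \<forall>q\<in>Q. d k q \<ge> e"
  shows "\<exists>k :: nat \<Rightarrow> 'k. \<forall>m n. m < n \<longrightarrow> d (k n) (k m) \<ge> e"
proof -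
  obtain c where c: "\<And>Q q. finite Q \<Longrightarrow> q \<in> Q \<Longrightarrow> d (c Q) q \<ge> e" using assms by metis
  define S where "S = rec_nat {} (\<lambda>_ Q. insert (c Q) Q)"
  have S: "S 0 = {}" "\<And>n. S (Suc n) = insert (c (S n)) (S n)" unfolding S_def by auto
  have "finite (S n)" for n by (induction n) (auto simp: S)
  moreover have "c (S m) \<in> S n" if "m < n" for m n
    using that by (induction n) (auto simp: S less_Suc_eq)
  ultimately show ?thesis using c by (intro exI[of _ "\<lambda>n. c (S n)"]) blast
qed

section \<open>Fair coin tossing and measurability along a scheme\<close>

definition coin_space :: "(nat \<Rightarrow> bool) measure" where
  "coin_space = PiM UNIV (\<lambda>_. measure_pmf (pmf_of_set (UNIV :: bool set)))"

lemma prob_space_coin_space: "prob_space coin_space"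
  unfolding coin_space_def by (intro prob_space_PiM measure_pmf.prob_space_axioms)

lemma space_coin_space [simp]: "space coin_space = UNIV"
  by (simp add: coin_space_def space_PiM)

lemma sets_coin_space_coordinate [measurable]: "{s. s i} \<in> sets coin_space"
proof -
  have "(\<lambda>s. s i) -` {True} \<inter> space coin_space \<in> sets coin_space"
    unfolding coin_space_def by (rule measurable_sets[OF measurable_component_singleton]) auto
  thus ?thesis by (simp add: vimage_def)
qed

lemma measure_coin_space_pair:
  assumes "i \<noteq> j"
  shows "measure coin_space {s. s i \<and> \<not> s j} = 1 / 4"
proof -
  interpret product_prob_space "\<lambda>_::nat. measure_pmf (pmf_of_set (UNIV :: bool set))" UNIV
    by unfold_locales
  have half: "emeasure (measure_pmf (pmf_of_set (UNIV :: bool set))) {b} = ennreal (1 / 2)" for b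
    by (subst measure_pmf.emeasure_eq_measure) (simp add: measure_pmf_single)
  \<comment> \<open>The singleton \<open>{k = i}\<close> contains True for \<open>k = i\<close> and
    False for \<open>k = j\<close>, so both constraints fit one product formula.\<close>
  have "emeasure coin_space {s\<in>space coin_space. \<forall>k\<in>{i, j}. s k \<in> {k = i}} =
    (\<Prod>k\<in>{i, j}. emeasure (measure_pmf (pmf_of_set (UNIV :: bool set))) {k = i})"
    unfolding coin_space_def by (rule emeasure_PiM_Collect) auto
  also have "\<dots> = ennreal (1 / 2) * ennreal (1 / 2)"
    using assms by (simp only: half prod.insert prod.empty finite.intros insert_iff empty_iff simp_thms mult_1_right)
  also have "\<dots> = ennreal (1 / 4)" by (subst ennreal_mult[symmetric]) auto
  also have "{s\<in>space coin_space. \<forall>k\<in>{i, j}. s k \<in> {k = i}} = {s. s i \<and> \<not> s j}"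
    using assms by auto
  finally show ?thesis by (simp add: measure_def)
qed

text \<open>Only finitely many coordinates matter. The induction splits on the last one;
  \<open>h\<close> is generalised so that this digit can be absorbed into it.\<close>

lemma borel_measurable_coin_space_truncate:
  fixes h :: "(nat \<Rightarrow> bool) \<Rightarrow> real"
  shows "(\<lambda>s. h (\<lambda>j. j < n \<and> s j)) \<in> borel_measurable coin_space"
proof (induction n arbitrary: h)
  case (Suc n)
  have "h (\<lambda>j. j < Suc n \<and> s j) = (if s n then (\<lambda>t. h (t(n := True))) (\<lambda>j. j < n \<and> s j)
      else (\<lambda>t. h (t(n := False))) (\<lambda>j. j < n \<and> s j))" for s
    by (auto intro!: arg_cong[of _ _ h] ext simp: less_Suc_eq split: if_splits)
  moreover have "Measurable.pred coin_space (\<lambda>s. s n)" by (simp add: pred_def)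
  ultimately show ?case
    using measurable_If[OF Suc.IH[of "\<lambda>t. h (t(n := True))"] Suc.IH[of "\<lambda>t. h (t(n := False))"], of "\<lambda>s. s n"]
    by simp
qed simp

lemma borel_measurable_coin_space_cantor:
  fixes g :: "'a::metric_space \<Rightarrow>\<^sub>C real"
  assumes "\<And>s. (\<lambda>n. w (\<lambda>j. j < n \<and> s j)) \<longlonglongrightarrow> w s"
  shows "(\<lambda>s. g (w s)) \<in> borel_measurable coin_space"
proof (rule borel_measurable_LIMSEQ_real)
  show "(\<lambda>n. g (w (\<lambda>j. j < n \<and> s j))) \<longlonglongrightarrow> g (w s)" for s
    using assms by (intro continuous_on_tendsto_compose[of UNIV "apply_bcontfun g"]) auto
  show "(\<lambda>s. g (w (\<lambda>j. j < n \<and> s j))) \<in> borel_measurable coin_space" for n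
    by (rule borel_measurable_coin_space_truncate[of "\<lambda>t. g (w t)"])
qed

text \<open>A scheme for \<open>y\<close> carries an L1 seminorm \<open>L\<close> in which the
  \<open>y (a i)\<close> are uniformly separated. Total boundedness of the \<open>f n\<close> would
  forbid this, so some subsequence \<open>f (k n)\<close> is separated too; a second use of the
  dichotomy, now for \<open>f\<close>, excludes that.\<close>

proposition convex_hull_pointwise_convergent_subseq:
  fixes f y :: "nat \<Rightarrow> 'a::metric_space \<Rightarrow>\<^sub>C real"
  assumes cpt: "compact (UNIV :: 'a set)" and bdd: "\<And>n. norm (f n) \<le> K"
    and noalt: "\<And>a p q. p < q \<Longrightarrow> \<exists>s. \<forall>x. \<not> alternating (\<lambda>j. f (a j)) p q s x"
    and y: "\<And>n. y n \<in> convex hull (range f)"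
  obtains r :: "nat \<Rightarrow> nat" where "strict_mono r" "\<And>x. convergent (\<lambda>n. y (r n) x)"
proof -
  have "convex hull (range f) \<subseteq> cball 0 K" using bdd by (intro hull_minimal) auto
  hence ybdd: "norm (y n) \<le> K" for n using y by (fastforce simp: subset_iff)
  show thesis
  proof (rule rosenthal_dichotomy[OF cpt ybdd])
    show thesis if "strict_mono r" "\<And>x. convergent (\<lambda>n. y (r n) x)" for r using that by fact
  next
    fix a p q w assume "p < q" and alt: "\<And>s. alternating (\<lambda>j. y (a j)) p q s (w s)"
      and lim: "\<And>s. (\<lambda>n. w (\<lambda>j. j < n \<and> s j)) \<longlonglongrightarrow> w s"
    interpret M: prob_space coin_space by (rule prob_space_coin_space)
    note meas [measurable] = borel_measurable_coin_space_cantor[of w, OF lim]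
    have int: "integrable coin_space (\<lambda>s. \<bar>apply_bcontfun g (w s)\<bar>)" for g :: "'a \<Rightarrow>\<^sub>C real"
      using norm_bounded[of g] by (intro M.integrable_const_bound[of _ "norm g"]) auto
    define L where "L g = (\<integral>s. \<bar>apply_bcontfun g (w s)\<bar> \<partial>coin_space)" for g :: "'a \<Rightarrow>\<^sub>C real"
    have tri: "L (g + h) \<le> L g + L h" for g h
      unfolding L_def Bochner_Integration.integral_add[OF int int, symmetric]
      by (intro integral_mono int Bochner_Integration.integrable_add) auto
    have scale: "L (c *\<^sub>R g) = \<bar>c\<bar> * L g" for c g
      unfolding L_def by (simp add: abs_mult)
    have le_norm: "L g \<le> norm g" for g
      unfolding L_def using norm_bounded[of g] by (intro M.integral_le_const int) auto
    have sep: "L (y (a i) - y (a j)) \<ge> (q - p) / 4" if "i \<noteq> j" for i j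
    proof -
      \<comment> \<open>On this event, of probability 1/4, the value of \<open>y (a i)\<close> at
        \<open>w s\<close> is above \<open>q\<close> and that of \<open>y (a j)\<close> below
        \<open>p\<close>.\<close>
      have "{s. s j \<and> \<not> s i} = {s. s j} - {s. s i}" by blast
      hence [measurable]: "{s. s j \<and> \<not> s i} \<in> sets coin_space" by simp
      have "(\<integral>s. (q - p) * indicator {s. s j \<and> \<not> s i} s \<partial>coin_space) \<le> L (y (a i) - y (a j))"
        unfolding L_def
      proof (rule integral_mono[OF _ int])
        show "integrable coin_space (\<lambda>s. (q - p) * indicator {s. s j \<and> \<not> s i} s)"
          by (intro integrable_mult_right M.integrable_const_bound[of _ 1])
            (auto intro: borel_measurable_indicator)
        show "(q - p) * indicator {s. s j \<and> \<not> s i} s \<le> \<bar>(y (a i) - y (a j)) (w s)\<bar>" for s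
          using alt[of s, unfolded alternating_def, THEN spec, of i]
            alt[of s, unfolded alternating_def, THEN spec, of j] \<open>p < q\<close>
          by (auto simp: indicator_def)
      qed
      thus ?thesis using measure_coin_space_pair[of j i] that by simp
    qed
    \<comment> \<open>Chosen so that \<open>3 * d\<close> is less than the separation
      \<open>(q - p) / 4\<close>.\<close>
    define d where "d = (q - p) / 16"
    have dpos: "d > 0" using \<open>p < q\<close> unfolding d_def by simp
    have "\<not> (\<exists>Q. finite Q \<and> (\<forall>k. \<exists>q\<in>Q. L (f k - f q) < d))"
    proof
      assume "\<exists>Q. finite Q \<and> (\<forall>k. \<exists>q\<in>Q. L (f k - f q) < d)"
      then obtain Q where "finite Q" "\<And>k. \<exists>q\<in>Q. L (f k - f q) < d" by blast
      then obtain m n where "m \<noteq> n" "L (y (a m) - y (a n)) \<le> 3 * d"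
        using seminorm_totally_bounded_convex_hull[of L Q f d "\<lambda>n. y (a n)"] tri scale le_norm y by metis
      thus False using sep[of m n] dpos unfolding d_def by simp
    qed
    hence not_tb: "\<exists>k. \<forall>q\<in>Q. L (f k - f q) \<ge> d" if "finite Q" for Q
      using that by (meson not_le)
    obtain k :: "nat \<Rightarrow> nat" where k: "\<And>m n. m < n \<Longrightarrow> L (f (k n) - f (k m)) \<ge> d"
      using not_totally_bounded_separated_seq[of d "\<lambda>i j. L (f i - f j)", OF not_tb] by auto
    show thesis
    proof (rule rosenthal_dichotomy[OF cpt, of "\<lambda>n. f (k n)" K])
      fix r assume r: "strict_mono r" "\<And>x. convergent (\<lambda>n. f (k (r n)) x)"
      \<comment> \<open>Consecutive differences tend to 0 pointwise and are bounded by
        \<open>2 * K\<close>, so their seminorms tend to 0, against the separation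
        \<open>d\<close>.\<close>
      have "(\<lambda>n. L (f (k (r (Suc n))) - f (k (r n)))) \<longlonglongrightarrow> (\<integral>s. 0 \<partial>coin_space)"
        unfolding L_def
      proof (rule integral_dominated_convergence[where w="\<lambda>_. 2 * K"])
        show "AE s in coin_space. (\<lambda>n. \<bar>(f (k (r (Suc n))) - f (k (r n))) (w s)\<bar>) \<longlonglongrightarrow> 0"
        proof (rule AE_I2)
          fix s
          obtain l where "(\<lambda>n. f (k (r n)) (w s)) \<longlonglongrightarrow> l" using r(2) convergent_def by blast
          hence "(\<lambda>n. f (k (r (Suc n))) (w s) - f (k (r n)) (w s)) \<longlonglongrightarrow> l - l"
            by (intro tendsto_diff LIMSEQ_Suc)
          thus "(\<lambda>n. \<bar>(f (k (r (Suc n))) - f (k (r n))) (w s)\<bar>) \<longlonglongrightarrow> 0"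
            by (simp add: tendsto_rabs_zero)
        qed
        show "AE s in coin_space. norm \<bar>(f (k (r (Suc n))) - f (k (r n))) (w s)\<bar> \<le> 2 * K" for n
          using norm_bounded[of "f (k (r (Suc n))) - f (k (r n))"]
            norm_triangle_ineq4[of "f (k (r (Suc n)))" "f (k (r n))"] bdd[of "k (r (Suc n))"] bdd[of "k (r n)"]
          by (intro AE_I2) (smt (verit) real_norm_def)
      qed (use int[THEN borel_measurable_integrable] in auto)
      moreover have "L (f (k (r (Suc n))) - f (k (r n))) \<ge> d" for n
        using k r(1) by (simp add: strict_mono_Suc_iff)
      ultimately have "0 \<ge> d" by (intro LIMSEQ_le_const[of _ 0 d]) auto
      thus thesis using dpos by simp
    next
      fix b p' q' w' assume "p' < q'" "\<And>s. alternating (\<lambda>j. f (k (b j))) p' q' s (w' s)"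
      thus thesis using noalt[of p' q' "\<lambda>j. k (b j)"] by blast
    qed (use bdd in auto)
  qed
qed

subsection \<open>Weak convergence in spaces of continuous functions\<close>

lemma ex_near_minimizer:
  fixes h :: "'b \<Rightarrow> real"
  assumes "C \<noteq> {}" "\<And>z. h z \<ge> 0" "e > 0"
  shows "\<exists>y\<in>C. \<forall>z\<in>C. h y \<le> h z + e"
proof -
  have bdd: "bdd_below (h ` C)" using assms(2) by (intro bdd_belowI[of _ 0]) auto
  obtain y where "y \<in> C" "h y < Inf (h ` C) + e"
    using cInf_lessD[of "h ` C" "Inf (h ` C) + e"] assms(1,3) by auto
  moreover have "Inf (h ` C) \<le> h z" if "z \<in> C" for z
    using bdd that by (simp add: cInf_lower)
  ultimately show ?thesis by (intro bexI[of _ y]) fastforce+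
qed

text \<open>
  The proof of Simons' inequality: the \<open>y n\<close> almost minimise the norm of \<open>s n + 2 * l n * y\<close> over
  tails of the convex hull; at a maximum of \<open>f = (\<Sum>n. l n * y n)\<close> the remainders \<open>f - s n\<close> then stay
  too large for the \<open>y n\<close> to tend to 0.
\<close>

proposition pointwise_null_convex_combination:
  fixes g :: "nat \<Rightarrow> 'a::metric_space \<Rightarrow>\<^sub>C real"
  assumes cpt: "compact (UNIV :: 'a set)" and nonneg: "\<And>n x. g n x \<ge> 0"
    and bdd: "\<And>n. norm (g n) \<le> K" and null: "\<And>x. (\<lambda>n. g n x) \<longlonglongrightarrow> 0" and "d > 0"
  shows "\<exists>z\<in>convex hull (range g). norm z < d"
proof (rule ccontr)
  assume "\<not> ?thesis"
  hence large: "norm z \<ge> d" if "z \<in> convex hull (range g)" for z using that by (meson not_less)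
  define C where "C n = convex hull (g ` {n..})" for n
  have C_mono: "C (Suc n) \<subseteq> C n" for n unfolding C_def by (intro hull_mono image_mono) auto
  have C_range: "C n \<subseteq> convex hull (range g)" for n unfolding C_def by (intro hull_mono) auto
  have C_ne: "C n \<noteq> {}" for n unfolding C_def by auto
  have C_norm: "norm z \<le> K" if "z \<in> C n" for z n
  proof -
    have "convex hull (range g) \<subseteq> cball 0 K" using bdd by (intro hull_minimal) auto
    thus ?thesis using that C_range by fastforce
  qed
  have C_le: "z x \<le> c" if "z \<in> C n" "\<And>m. m \<ge> n \<Longrightarrow> g m x \<le> c" for z x n c
  proof -
    have "convex {z :: 'a \<Rightarrow>\<^sub>C real. z x \<le> c}"
      by (rule convexI) (simp add: convex_bound_le)
    hence "C n \<subseteq> {z :: 'a \<Rightarrow>\<^sub>C real. z x \<le> c}" unfolding C_def using that(2) by (intro hull_minimal) auto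
    thus ?thesis using that(1) by auto
  qed
  have C_nonneg: "0 \<le> z x" if "z \<in> C n" for z x n
  proof -
    have "convex {z :: 'a \<Rightarrow>\<^sub>C real. 0 \<le> z x}" by (rule convexI) simp
    hence "C n \<subseteq> {z :: 'a \<Rightarrow>\<^sub>C real. 0 \<le> z x}" unfolding C_def using nonneg by (intro hull_minimal) auto
    thus ?thesis using that by auto
  qed
  define l :: "nat \<Rightarrow> real" where "l n = (1 / 2) ^ n" for n
  have l: "l n > 0" "l 0 = 1" "l (Suc n) = l n / 2" for n unfolding l_def by auto
  \<comment> \<open>The tolerance \<open>d * (l n)^2 / 2\<close> is what the induction for
    \<open>gap\<close> can afford: it costs \<open>d * (l n)^2 / 4\<close> out of the available
    \<open>d * (l n)^2 / 2\<close>.\<close>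
  define Q where "Q n s y \<longleftrightarrow> y \<in> C n \<and>
    (\<forall>z\<in>C n. norm (s + (2 * l n) *\<^sub>R y) \<le> norm (s + (2 * l n) *\<^sub>R z) + l n * (d * l n / 2))"
    for n and s y :: "'a \<Rightarrow>\<^sub>C real"
  have Q: "\<exists>y. Q n s y" for n s
  proof -
    have "l n * (d * l n / 2) > 0" using l(1)[of n] \<open>d > 0\<close> by simp
    from ex_near_minimizer[OF C_ne _ this, of "\<lambda>y. norm (s + (2 * l n) *\<^sub>R y)" n]
    show ?thesis unfolding Q_def by auto
  qed
  obtain s where s: "s 0 = 0" "\<And>n. \<exists>y. Q n (s n) y \<and> s (Suc n) = s n + l n *\<^sub>R y"
  proof -
    have "\<exists>s. \<forall>n. (n = 0 \<longrightarrow> s n = 0) \<and> (\<exists>y. Q n (s n) y \<and> s (Suc n) = s n + l n *\<^sub>R y)"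
      by (rule dependent_nat_choice) (use Q in auto)
    thus thesis using that by blast
  qed
  then obtain y where y: "\<And>n. Q n (s n) (y n)" "\<And>n. s (Suc n) = s n + l n *\<^sub>R y n" by metis
  have yC: "y n \<in> C n" for n using y(1) unfolding Q_def by blast
  have l_null: "l \<longlonglongrightarrow> 0" unfolding l_def by (intro LIMSEQ_power_zero) simp
  have s_diff: "norm (s n - s m) \<le> 2 * K * (l m - l n)" if "m \<le> n" for m n
    using that
  proof (induction n rule: dec_induct)
    case (step n)
    have "norm (s (Suc n) - s m) \<le> norm (s n - s m) + norm (l n *\<^sub>R y n)"
      using norm_triangle_ineq[of "s n - s m" "l n *\<^sub>R y n"] by (simp add: y(2) algebra_simps)
    moreover have "norm (l n *\<^sub>R y n) \<le> l n * K"
      using C_norm[OF yC, of n] l(1)[of n] by simp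
    ultimately show ?case using step by (simp add: l(3) algebra_simps)
  qed simp
  have K: "K \<ge> 0" using bdd[of 0] norm_ge_zero order_trans by blast
  have "Cauchy s"
  proof (rule CauchyI')
    fix e :: real assume "e > 0"
    moreover have "(\<lambda>n. 2 * K * l n) \<longlonglongrightarrow> 0" using tendsto_mult_right_zero[OF l_null] .
    ultimately obtain M where M: "\<And>m. m \<ge> M \<Longrightarrow> 2 * K * l m < e"
      using order_tendstoD(2) by (fastforce simp: eventually_sequentially)
    have "dist (s m) (s n) < e" if "m \<ge> M" "n > m" for m n
    proof -
      have "2 * K * (l m - l n) \<le> 2 * K * l m" using K l(1)[of n] by (intro mult_left_mono) auto
      thus ?thesis using s_diff[of m n] M[of m] that by (simp add: dist_norm norm_minus_commute)
    qed
    thus "\<exists>M. \<forall>m\<ge>M. \<forall>n>m. dist (s m) (s n) < e" by blast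
  qed
  then obtain f where f: "s \<longlonglongrightarrow> f" using Cauchy_convergent convergent_def by blast
  have fx: "(\<lambda>n. s n x) \<longlonglongrightarrow> f x" for x
    using tendsto_uniform_limitI[OF tendsto_bcontfun_uniform_limit[OF f]] by simp
  have f_nonneg: "f x \<ge> 0" for x
  proof (rule LIMSEQ_le_const[OF fx])
    have "s n x \<ge> 0" for n
    proof (induction n)
      case (Suc n)
      have "l n * y n x \<ge> 0" using l(1)[of n] C_nonneg[OF yC, of n x] by simp
      thus ?case using Suc by (simp add: y(2))
    qed (simp add: s(1))
    thus "\<exists>N. \<forall>n\<ge>N. 0 \<le> s n x" by blast
  qed
  \<comment> \<open>As \<open>f\<close> is nonnegative, its maximum is its norm.\<close>
  obtain x where "\<And>t. f t \<le> f x"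
    using continuous_attains_sup[OF cpt, of "apply_bcontfun f"] by auto
  hence norm_f: "norm f \<le> f x" using f_nonneg by (intro norm_bound) auto
  \<comment> \<open>The weights from \<open>N\<close> on sum to \<open>2 * l N\<close>, so
    \<open>v N\<close> is \<open>f\<close> with its whole tail concentrated on
    \<open>y N\<close>.\<close>
  define v where "v N = s N + (2 * l N) *\<^sub>R y N" for N
  have v_lim: "v \<longlonglongrightarrow> f"
  proof -
    have "(\<lambda>N. (2 * l N) *\<^sub>R y N) \<longlonglongrightarrow> 0"
    proof (rule Lim_null_comparison)
      show "\<forall>\<^sub>F N in sequentially. norm ((2 * l N) *\<^sub>R y N) \<le> 2 * l N * K"
        using C_norm[OF yC] l(1) by (intro always_eventually) (simp add: abs_of_pos)
      show "(\<lambda>N. 2 * l N * K) \<longlonglongrightarrow> 0"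
        using tendsto_mult_left_zero[OF tendsto_mult_right_zero[OF l_null, of 2], of K] .
    qed
    from tendsto_add[OF f this] show ?thesis unfolding v_def by simp
  qed
  \<comment> \<open>Averaging with \<open>y n\<close>, downwards from \<open>N\<close>, shows that
    \<open>v N\<close> is a competitor in the minimisation at every stage up to
    \<open>N\<close>.\<close>
  have v_rep: "\<exists>u\<in>C n. v N = s n + (2 * l n) *\<^sub>R u" if "n \<le> N" for n N
    using that
  proof (induction n rule: inc_induct)
    case base then show ?case unfolding v_def using yC by blast
  next
    case (step n)
    then obtain u where u: "u \<in> C (Suc n)" "v N = s (Suc n) + (2 * l (Suc n)) *\<^sub>R u" by blast
    have "(1/2) *\<^sub>R y n + (1/2) *\<^sub>R u \<in> C n"
      using convexD[of "C n" "y n" u "1/2" "1/2"] yC u(1) C_mono unfolding C_def by auto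
    moreover have "v N = s n + (2 * l n) *\<^sub>R ((1/2) *\<^sub>R y n + (1/2) *\<^sub>R u)"
      using u(2) l(3) by (simp add: y(2) algebra_simps)
    ultimately show ?case by blast
  qed
  have v_norm: "norm (v n) \<le> norm f + l n * (d * l n / 2)" for n
  proof (rule LIMSEQ_le_const)
    show "(\<lambda>N. norm (v N) + l n * (d * l n / 2)) \<longlonglongrightarrow> norm f + l n * (d * l n / 2)"
      by (intro tendsto_intros v_lim)
    have "norm (v n) \<le> norm (v N) + l n * (d * l n / 2)" if "n \<le> N" for N
      using v_rep[OF that] y(1)[of n] unfolding Q_def v_def[of n] by auto
    thus "\<exists>M. \<forall>N\<ge>M. norm (v n) \<le> norm (v N) + l n * (d * l n / 2)" by blast
  qed
  have f_large: "norm f \<ge> 2 * d"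
  proof (rule LIMSEQ_le_const)
    show "(\<lambda>N. norm (v N)) \<longlonglongrightarrow> norm f" by (intro tendsto_intros v_lim)
    have "norm (v N) \<ge> 2 * d" for N
      using v_rep[of 0 N] large C_range s(1) l(2) by fastforce
    thus "\<exists>M. \<forall>N\<ge>M. 2 * d \<le> norm (v N)" by blast
  qed
  have gap: "f x - s n x \<ge> l n * (d + d * l n)" for n
  proof (induction n)
    case 0 then show ?case using f_large norm_f s(1) l(2) by simp
  next
    case (Suc n)
    have "s n x + 2 * l n * y n x \<le> f x + l n * (d * l n / 2)"
      using norm_bounded[of "v n" x] v_norm[of n] norm_f unfolding v_def by simp
    thus ?case using Suc by (simp add: y(2) l(3) algebra_simps)
  qed
  \<comment> \<open>From \<open>N\<close> on the \<open>y n\<close> are at most \<open>d / 4\<close>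
    at \<open>x\<close>, so \<open>f x - s N x\<close> is at most \<open>d / 2 * l N\<close>, less
    than the lower bound in \<open>gap\<close>.\<close>
  obtain N where N: "\<And>m. m \<ge> N \<Longrightarrow> g m x < d / 4"
    using order_tendstoD(2)[OF null, of "d/4" x] \<open>d > 0\<close> by (auto simp: eventually_sequentially)
  have "s n x \<le> s N x + d / 2 * (l N - l n)" if "n \<ge> N" for n
    using that
  proof (induction n rule: dec_induct)
    case (step n)
    have "y n x \<le> d / 4" using C_le[OF yC] N step(1) by (meson less_imp_le order_trans)
    hence *: "l n * y n x \<le> l n * (d / 4)" by (rule mult_left_mono) (simp add: l(1) less_imp_le)
    have "s (Suc n) x = s n x + l n * y n x" by (simp add: y(2))
    also have "\<dots> \<le> s N x + d / 2 * (l N - l n) + l n * (d / 4)" using step.IH * by linarith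
    also have "\<dots> = s N x + d / 2 * (l N - l (Suc n))" by (simp add: l(3) field_simps)
    finally show ?case .
  qed simp
  moreover have "s N x + d / 2 * (l N - l n) \<le> s N x + d / 2 * l N" for n
    using l(1)[of n] \<open>d > 0\<close> by (simp add: algebra_simps)
  ultimately have "\<exists>M. \<forall>n\<ge>M. s n x \<le> s N x + d / 2 * l N" by (meson order_trans)
  hence "f x \<le> s N x + d / 2 * l N" by (rule LIMSEQ_le_const2[OF fx])
  moreover have "d * l N > 0" "l N * (d * l N) > 0" using l(1)[of N] \<open>d > 0\<close> by simp_all
  ultimately show False using gap[of N] by (simp add: algebra_simps)
qed

lemma not_null_subseq:
  fixes X :: "nat \<Rightarrow> real"
  assumes "\<not> X \<longlonglongrightarrow> 0"
  obtains e r where "e > 0" "strict_mono (r :: nat \<Rightarrow> nat)" "\<And>n. \<bar>X (r n)\<bar> \<ge> e"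
proof -
  obtain e where e: "e > 0" "\<not> eventually (\<lambda>n. \<bar>X n\<bar> < e) sequentially"
    using assms unfolding tendsto_iff by auto
  hence "infinite {n. \<bar>X n\<bar> \<ge> e}"
    by (simp add: cofinite_eq_sequentially[symmetric] eventually_cofinite not_less)
  thus thesis using that[OF e(1) strict_mono_enumerate] enumerate_in_set by blast
qed

text \<open>Otherwise sign changes on a subsequence give \<open>h n\<close> with
  \<open>\<mu> (h n) \<ge> e\<close>. A convex combination of the moduli with small norm dominates
  the same combination of the \<open>h n\<close>, whose value under \<open>\<mu>\<close> is still at
  least \<open>e\<close>.\<close>

theorem pointwise_null_imp_weakly_null:
  fixes z :: "nat \<Rightarrow> 'a::metric_space \<Rightarrow>\<^sub>C real" and \<mu> :: "('a \<Rightarrow>\<^sub>C real) \<Rightarrow>\<^sub>L real"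
  assumes cpt: "compact (UNIV :: 'a set)" and bdd: "\<And>n. norm (z n) \<le> K"
    and null: "\<And>x. (\<lambda>n. z n x) \<longlonglongrightarrow> 0"
  shows "(\<lambda>n. \<mu> (z n)) \<longlonglongrightarrow> 0"
proof (rule ccontr)
  assume "\<not> ?thesis"
  then obtain e r where e: "e > 0" and r: "strict_mono (r :: nat \<Rightarrow> nat)" "\<And>n. \<bar>\<mu> (z (r n))\<bar> \<ge> e"
    by (rule not_null_subseq) (use that in blast)
  define h where "h n = sgn (\<mu> (z (r n))) *\<^sub>R z (r n)" for n
  have h_mu: "\<mu> (h n) \<ge> e" for n
    using r(2)[of n] by (simp add: h_def blinfun.scaleR_right abs_sgn[symmetric] mult.commute)
  have "\<exists>g. \<forall>x. apply_bcontfun g x = \<bar>h n x\<bar>" for n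
  proof -
    have "(\<lambda>x. \<bar>h n x\<bar>) \<in> bcontfun"
      using norm_bounded[of "h n"] by (intro bcontfun_normI[of _ "norm (h n)"] continuous_intros) auto
    thus ?thesis by (metis bcontfunE)
  qed
  then obtain g where g: "\<And>n x. apply_bcontfun (g n) x = \<bar>h n x\<bar>" by metis
  have abs_h: "\<bar>h n x\<bar> \<le> \<bar>z (r n) x\<bar>" for n x
    by (simp add: h_def abs_mult abs_sgn_eq)
  \<comment> \<open>Adding 1 to the norm of \<open>\<mu>\<close> keeps the bound positive also for
    the zero functional.\<close>
  have "\<exists>w\<in>convex hull (range g). norm w < e / (norm \<mu> + 1)"
  proof (rule pointwise_null_convex_combination[OF cpt])
    show "norm (g n) \<le> K" for n
    proof (rule norm_bound)
      show "norm (g n x) \<le> K" for x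
        using abs_h[of n x] norm_bounded[of "z (r n)" x] bdd[of "r n"] by (simp add: g)
    qed
    show "(\<lambda>n. g n x) \<longlonglongrightarrow> 0" for x
    proof (rule Lim_null_comparison)
      show "(\<lambda>n. \<bar>z (r n) x\<bar>) \<longlonglongrightarrow> 0"
        using LIMSEQ_subseq_LIMSEQ[OF null r(1)] by (intro tendsto_rabs_zero) (simp add: comp_def)
    qed (use abs_h in \<open>simp add: g\<close>)
    show "e / (norm \<mu> + 1) > 0" using e by (simp add: add_nonneg_pos)
  qed (simp add: g)
  then obtain w where w: "w \<in> convex hull (range g)" "norm w < e / (norm \<mu> + 1)" by blast
  \<comment> \<open>Recording a dominated \<open>u\<close> in a convex set replaces explicit
    coefficients of the convex combination.\<close>
  define D where "D = {w :: 'a \<Rightarrow>\<^sub>C real. \<exists>u :: 'a \<Rightarrow>\<^sub>C real. (\<forall>x. \<bar>apply_bcontfun u x\<bar> \<le> apply_bcontfun w x) \<and> blinfun_apply \<mu> u \<ge> e}"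
  have "convex D"
  proof (rule convexI)
    fix w1 w2 :: "'a \<Rightarrow>\<^sub>C real" and a b :: real
    assume "w1 \<in> D" "w2 \<in> D" and ab: "0 \<le> a" "0 \<le> b" "a + b = 1"
    then obtain u1 u2 :: "'a \<Rightarrow>\<^sub>C real" where u: "\<And>x. \<bar>u1 x\<bar> \<le> w1 x" "\<mu> u1 \<ge> e" "\<And>x. \<bar>u2 x\<bar> \<le> w2 x" "\<mu> u2 \<ge> e"
      unfolding D_def by blast
    have "\<bar>a * u1 x + b * u2 x\<bar> \<le> a * w1 x + b * w2 x" for x
      using abs_triangle_ineq[of "a * u1 x" "b * u2 x"] mult_left_mono[OF u(1) ab(1), of x]
        mult_left_mono[OF u(3) ab(2), of x] ab by (simp add: abs_mult)
    moreover have "\<mu> (a *\<^sub>R u1 + b *\<^sub>R u2) \<ge> e"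
    proof -
      have "a * e + b * e \<le> a * \<mu> u1 + b * \<mu> u2" using u ab by (intro add_mono mult_left_mono) auto
      moreover have "a * e + b * e = e" using ab(3) by (metis distrib_right mult_1)
      ultimately show ?thesis by (simp add: blinfun.add_right blinfun.scaleR_right)
    qed
    ultimately show "a *\<^sub>R w1 + b *\<^sub>R w2 \<in> D" unfolding D_def by (auto intro!: exI[of _ "a *\<^sub>R u1 + b *\<^sub>R u2"])
  qed
  moreover have "range g \<subseteq> D" unfolding D_def using h_mu by (auto simp: g)
  ultimately have "w \<in> D" using w(1) hull_minimal[of "range g" D convex] by blast
  then obtain u :: "'a \<Rightarrow>\<^sub>C real" where u: "\<And>x. \<bar>u x\<bar> \<le> w x" "\<mu> u \<ge> e" unfolding D_def by blast
  have "norm u \<le> norm w"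
  proof (rule norm_bound)
    show "norm (u x) \<le> norm w" for x using u(1)[of x] norm_bounded[of w x] by simp
  qed
  hence "\<mu> u \<le> norm \<mu> * norm w"
    using norm_blinfun[of \<mu> u] mult_left_mono[of "norm u" "norm w" "norm \<mu>"] by (simp add: abs_le_iff)
  also have "\<dots> \<le> (norm \<mu> + 1) * norm w" by (intro mult_right_mono) auto
  also have "\<dots> < e"
    using w(2) pos_less_divide_eq[of "norm \<mu> + 1" "norm w" e] by (simp add: add_nonneg_pos mult.commute)
  finally show False using u(2) by simp
qed

text \<open>The pointwise limit may be discontinuous, so the Cauchy property is used: differences
  along two index sequences tending to infinity are pointwise null.\<close>

corollary pointwise_convergent_imp_weakly_convergent:
  fixes y :: "nat \<Rightarrow> 'a::metric_space \<Rightarrow>\<^sub>C real" and \<mu> :: "('a \<Rightarrow>\<^sub>C real) \<Rightarrow>\<^sub>L real"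
  assumes cpt: "compact (UNIV :: 'a set)" and bdd: "\<And>n. norm (y n) \<le> K"
    and conv: "\<And>x. convergent (\<lambda>n. y n x)"
  shows "convergent (\<lambda>n. \<mu> (y n))"
proof (rule ccontr)
  assume "\<not> ?thesis"
  then obtain e where e: "e > 0" "\<And>M. \<exists>m\<ge>M. \<exists>n\<ge>M. \<not> dist (\<mu> (y m)) (\<mu> (y n)) < e"
    unfolding Cauchy_convergent_iff[symmetric] Cauchy_def by blast
  then obtain m n where mn: "\<And>M. m M \<ge> M" "\<And>M. n M \<ge> M" "\<And>M. \<not> dist (\<mu> (y (m M))) (\<mu> (y (n M))) < e"
    by metis
  have lim: "filterlim m at_top sequentially" "filterlim n at_top sequentially"
    using mn(1,2) by (auto intro!: filterlim_at_top_mono[OF filterlim_ident])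
  have "(\<lambda>M. \<mu> (y (m M) - y (n M))) \<longlonglongrightarrow> 0"
  proof (rule pointwise_null_imp_weakly_null[OF cpt])
    show "norm (y (m M) - y (n M)) \<le> 2 * K" for M
      using norm_triangle_ineq4[of "y (m M)" "y (n M)"] bdd[of "m M"] bdd[of "n M"] by simp
    fix x
    obtain l where "(\<lambda>n. y n x) \<longlonglongrightarrow> l" using conv convergent_def by blast
    from tendsto_diff[OF filterlim_compose[OF this lim(1)] filterlim_compose[OF this lim(2)]]
    show "(\<lambda>M. (y (m M) - y (n M)) x) \<longlonglongrightarrow> 0" by simp
  qed
  from tendstoD[OF this e(1)] obtain M where "dist (\<mu> (y (m M) - y (n M))) 0 < e"
    by (auto simp: eventually_sequentially)
  thus False using mn(3)[of M] by (simp add: blinfun.diff_right dist_real_def)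
qed

subsection \<open>Koopman operators\<close>

text \<open>\<open>Blinfun\<close> and \<open>Bcontfun\<close> can be evaluated only once linearity,
  boundedness and continuity are checked; continuity of \<open>\<phi>\<close> makes
  \<open>koopman\<close> the composition operator.\<close>

lemma koopman_apply:
  assumes "continuous_on UNIV \<phi>"
  shows "apply_bcontfun (blinfun_apply (koopman \<phi>) x) \<omega> = x (\<phi> \<omega>)"
proof -
  have mem: "(\<lambda>\<omega>. apply_bcontfun x (\<phi> \<omega>)) \<in> bcontfun" for x :: "'a \<Rightarrow>\<^sub>C real"
    using norm_bounded[of x]
    by (intro bcontfun_normI[of _ "norm x"] continuous_on_compose2[OF _ assms]) auto
  have app: "apply_bcontfun (Bcontfun (\<lambda>\<omega>. apply_bcontfun x (\<phi> \<omega>))) \<omega> = x (\<phi> \<omega>)"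
    for x :: "'a \<Rightarrow>\<^sub>C real" and \<omega>
    by (simp add: Bcontfun_inverse[OF mem])
  have "bounded_linear (\<lambda>x :: 'a \<Rightarrow>\<^sub>C real. Bcontfun (\<lambda>\<omega>. apply_bcontfun x (\<phi> \<omega>)))"
  proof (rule bounded_linear_intro[where K=1])
    show "norm (Bcontfun (\<lambda>\<omega>. apply_bcontfun x (\<phi> \<omega>))) \<le> norm x * 1" for x :: "'a \<Rightarrow>\<^sub>C real"
      using norm_bounded[of x] by (intro norm_bound) (simp add: app)
    show "Bcontfun (\<lambda>\<omega>. apply_bcontfun (x + y) (\<phi> \<omega>)) =
        Bcontfun (\<lambda>\<omega>. apply_bcontfun x (\<phi> \<omega>)) + Bcontfun (\<lambda>\<omega>. apply_bcontfun y (\<phi> \<omega>))"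
      for x y :: "'a \<Rightarrow>\<^sub>C real"
      by (rule bcontfun_eqI) (metis app plus_bcontfun.rep_eq)
    show "Bcontfun (\<lambda>\<omega>. apply_bcontfun (c *\<^sub>R x) (\<phi> \<omega>)) = c *\<^sub>R Bcontfun (\<lambda>\<omega>. apply_bcontfun x (\<phi> \<omega>))"
      for c and x :: "'a \<Rightarrow>\<^sub>C real"
      by (rule bcontfun_eqI) (metis app scaleR_bcontfun.rep_eq)
  qed
  thus ?thesis unfolding koopman_def by (simp add: bounded_linear_Blinfun_apply app)
qed

lemma dual_koopman_apply: "blinfun_apply (dual_koopman \<phi>) \<mu> = \<mu> o\<^sub>L koopman \<phi>"
  unfolding dual_koopman_def
  by (simp add: bounded_linear_Blinfun_apply bounded_bilinear.bounded_linear_left[OF bounded_bilinear_blinfun_compose])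

lemma blinfun_compose_assoc: "(f o\<^sub>L g) o\<^sub>L h = f o\<^sub>L (g o\<^sub>L h)"
  by (rule blinfun_eqI) simp

lemma op_pow_0 [simp]: "op_pow T 0 = id_blinfun" by (simp add: op_pow_def)

lemma op_pow_Suc [simp]: "op_pow T (Suc n) = T o\<^sub>L op_pow T n" by (simp add: op_pow_def)

lemma op_pow_Suc_right: "op_pow T (Suc n) = op_pow T n o\<^sub>L T"
proof (induction n)
  case (Suc n)
  have "op_pow T (Suc (Suc n)) = T o\<^sub>L (op_pow T n o\<^sub>L T)" using Suc by simp
  thus ?case by (simp add: blinfun_compose_assoc)
qed (simp add: blinfun_eqI)

text \<open>Adjoints reverse composition, so the new factor appears on the right of the
  power.\<close>

lemma op_pow_dual_koopman:
  "blinfun_apply (op_pow (dual_koopman \<phi>) n) \<mu> = \<mu> o\<^sub>L op_pow (koopman \<phi>) n"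
proof (induction n)
  case (Suc n)
  have "blinfun_apply (op_pow (dual_koopman \<phi>) (Suc n)) \<mu> = (\<mu> o\<^sub>L op_pow (koopman \<phi>) n) o\<^sub>L koopman \<phi>"
    using Suc by (simp add: dual_koopman_apply)
  thus ?case by (simp only: blinfun_compose_assoc op_pow_Suc_right)
qed (simp add: blinfun_eqI)

lemma norm_koopman_pow_le:
  assumes "continuous_on UNIV \<phi>"
  shows "norm (op_pow (koopman \<phi>) n) \<le> 1"
proof (induction n)
  case 0
  show ?case by (simp add: norm_blinfun_id_le)
next
  case (Suc n)
  have "norm (koopman \<phi>) \<le> 1"
  proof (rule norm_blinfun_bound)
    show "norm (blinfun_apply (koopman \<phi>) x) \<le> 1 * norm x" for x
      using norm_bounded[of x] by (intro norm_bound) (simp add: koopman_apply[OF assms])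
  qed simp
  hence "norm (koopman \<phi>) * norm (op_pow (koopman \<phi>) n) \<le> 1 * 1"
    using Suc by (intro mult_mono) auto
  thus ?case using norm_blinfun_compose[of "koopman \<phi>" "op_pow (koopman \<phi>) n"] by simp
qed

abbreviation koopman_hull :: "('a::metric_space \<Rightarrow> 'a) \<Rightarrow> (('a \<Rightarrow>\<^sub>C real) \<Rightarrow>\<^sub>L ('a \<Rightarrow>\<^sub>C real)) set" where
  "koopman_hull \<phi> \<equiv> convex hull (range (op_pow (koopman \<phi>)))"

lemma koopman_hull_norm_le:
  assumes "continuous_on UNIV \<phi>" "w \<in> koopman_hull \<phi>"
  shows "norm (blinfun_apply w x) \<le> norm x"
proof -
  have "koopman_hull \<phi> \<subseteq> cball 0 1"
    using norm_koopman_pow_le[OF assms(1)] by (intro hull_minimal) auto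
  hence "norm w \<le> 1" using assms(2) by auto
  thus ?thesis using norm_blinfun[of w x] mult_right_mono[of "norm w" 1 "norm x"] by simp
qed

lemma koopman_hull_orbit:
  assumes "w \<in> koopman_hull \<phi>"
  shows "blinfun_apply w x \<in> convex hull (range (\<lambda>k. blinfun_apply (op_pow (koopman \<phi>) k) x))"
    (is "_ \<in> ?H")
proof -
  have "convex {w. blinfun_apply w x \<in> ?H}"
  proof (rule convexI)
    fix v w :: "('a \<Rightarrow>\<^sub>C real) \<Rightarrow>\<^sub>L ('a \<Rightarrow>\<^sub>C real)" and a b :: real
    assume "v \<in> {w. blinfun_apply w x \<in> ?H}" "w \<in> {w. blinfun_apply w x \<in> ?H}" "0 \<le> a" "0 \<le> b" "a + b = 1"
    thus "a *\<^sub>R v + b *\<^sub>R w \<in> {w. blinfun_apply w x \<in> ?H}"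
      by (simp add: blinfun.add_left blinfun.scaleR_left convexD[OF convex_convex_hull])
  qed
  moreover have "range (op_pow (koopman \<phi>)) \<subseteq> {w. blinfun_apply w x \<in> ?H}" by (auto intro: hull_inc)
  ultimately have "koopman_hull \<phi> \<subseteq> {w. blinfun_apply w x \<in> ?H}" by (intro hull_minimal)
  thus ?thesis using assms by blast
qed

text \<open>Reduces operators on the dual to operators on C(\<Omega>): having a preadjoint in
  \<open>koopman_hull\<close> is a convex property, and the powers have it.\<close>

lemma dual_koopman_hull_preadjoint:
  assumes "W \<in> convex hull (range (op_pow (dual_koopman \<phi>)))"
  shows "\<exists>w\<in>koopman_hull \<phi>. \<forall>\<mu>. blinfun_apply W \<mu> = \<mu> o\<^sub>L w"
proof -
  define D where "D = {W :: 'a opdualC. \<exists>w\<in>koopman_hull \<phi>. \<forall>\<mu>. blinfun_apply W \<mu> = \<mu> o\<^sub>L w}"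
  have "convex D"
  proof (rule convexI)
    fix V W :: "'a opdualC" and a b :: real
    assume "V \<in> D" "W \<in> D" and ab: "0 \<le> a" "0 \<le> b" "a + b = 1"
    then obtain v w where v: "v \<in> koopman_hull \<phi>" "\<And>\<mu>. blinfun_apply V \<mu> = \<mu> o\<^sub>L v"
      and w: "w \<in> koopman_hull \<phi>" "\<And>\<mu>. blinfun_apply W \<mu> = \<mu> o\<^sub>L w" unfolding D_def by blast
    have "blinfun_apply (a *\<^sub>R V + b *\<^sub>R W) \<mu> = \<mu> o\<^sub>L (a *\<^sub>R v + b *\<^sub>R w)" for \<mu>
      by (rule blinfun_eqI) (simp add: blinfun.add_left blinfun.scaleR_left blinfun.add_right blinfun.scaleR_right v(2) w(2))
    moreover have "a *\<^sub>R v + b *\<^sub>R w \<in> koopman_hull \<phi>" using convexD[OF convex_convex_hull v(1) w(1) ab] .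
    ultimately show "a *\<^sub>R V + b *\<^sub>R W \<in> D" unfolding D_def by blast
  qed
  moreover have "range (op_pow (dual_koopman \<phi>)) \<subseteq> D"
    unfolding D_def using op_pow_dual_koopman by (auto intro!: bexI hull_inc)
  ultimately have "convex hull (range (op_pow (dual_koopman \<phi>))) \<subseteq> D" by (intro hull_minimal)
  thus ?thesis using assms unfolding D_def by blast
qed

section \<open>Separability of C(\<Omega>) and the diagonal subsequence\<close>

lemma bcontfun_separable:
  assumes cpt: "compact (UNIV :: 'a::metric_space set)"
  shows "\<exists>D :: nat \<Rightarrow> 'a \<Rightarrow>\<^sub>C real. \<forall>x e. e > 0 \<longrightarrow> (\<exists>n. norm (x - D n) < e)"
proof -
  have "\<exists>ps. (UNIV::'a set) \<subseteq> (\<Union>p\<in>set ps. ball p (1 / real (Suc n)))" for n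
  proof -
    have "1 / real (Suc n) > 0" by simp
    then obtain k where "finite k" "(UNIV::'a set) \<subseteq> (\<Union>x\<in>k. ball x (1 / real (Suc n)))"
      using compact_eq_totally_bounded[of "UNIV :: 'a set"] cpt by blast
    thus ?thesis using finite_list[of k] by auto
  qed
  then obtain ps where ps: "\<And>n. (UNIV::'a set) \<subseteq> (\<Union>p\<in>set (ps n). ball p (1 / real (Suc n)))" by metis
  \<comment> \<open>A modulus of continuity at one scale, together with values rounded down to
    multiples of \<open>1 / (k+1)\<close> on a finite net, determines a function up to
    \<open>3 / (k+1)\<close>; such codes are countable.\<close>
  define osc where "osc n k x \<longleftrightarrow> (\<forall>u v. dist u v < 1 / real (Suc n) \<longrightarrow> \<bar>x u - x v\<bar> < 1 / real (Suc k))"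
    for n k and x :: "'a \<Rightarrow>\<^sub>C real"
  define code where "code n k x = map (\<lambda>p. \<lfloor>real (Suc k) * x p\<rfloor>) (ps n)" for n k and x :: "'a \<Rightarrow>\<^sub>C real"
  \<comment> \<open>A junk value if no \<open>x\<close> matches the code; it is only used for codes of actual functions.\<close>
  define D where "D c = (case c of (n, k, vs) \<Rightarrow> SOME x. osc n k x \<and> code n k x = vs)"
    for c :: "nat \<times> nat \<times> int list"
  have "\<exists>c. norm (x - D c) < e" if "e > 0" for x e
  proof -
    obtain k where k: "1 / real (Suc k) < e / 3" using nat_approx_posE[of "e/3"] \<open>e > 0\<close> by auto
    have "uniformly_continuous_on UNIV (apply_bcontfun x)"
      by (intro compact_uniformly_continuous cpt) auto
    then obtain d where d: "d > 0" "\<And>u v. dist u v < d \<Longrightarrow> dist (x u) (x v) < 1 / real (Suc k)"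
      unfolding uniformly_continuous_on_def by (metis UNIV_I of_nat_0_less_iff zero_less_Suc zero_less_divide_1_iff)
    obtain n where n: "1 / real (Suc n) < d" using nat_approx_posE[OF d(1)] by auto
    define y where "y = D (n, k, code n k x)"
    have x: "osc n k x" unfolding osc_def using d(2) n by (auto simp: dist_real_def simp del: of_nat_Suc)
    have y: "osc n k y" "code n k y = code n k x"
      using someI[of "\<lambda>z. osc n k z \<and> code n k z = code n k x" x] x unfolding y_def D_def by auto
    have "norm ((x - y) t) \<le> 3 * (1 / real (Suc k))" for t
    proof -
      obtain p where p: "p \<in> set (ps n)" "dist p t < 1 / real (Suc n)"
        using subsetD[OF ps[of n], of t] by (auto simp del: of_nat_Suc)
      have "\<lfloor>real (Suc k) * x p\<rfloor> = \<lfloor>real (Suc k) * y p\<rfloor>" using y(2) p(1) unfolding code_def by simp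
      hence "\<bar>real (Suc k) * x p - real (Suc k) * y p\<bar> < 1" by linarith
      hence "real (Suc k) * \<bar>x p - y p\<bar> < 1"
        by (simp only: right_diff_distrib[symmetric] abs_mult abs_of_nat)
      hence "\<bar>x p - y p\<bar> < 1 / real (Suc k)"
        by (simp only: pos_less_divide_eq[of "real (Suc k)"] of_nat_0_less_iff zero_less_Suc mult.commute)
      moreover have "\<bar>x p - x t\<bar> < 1 / real (Suc k)" "\<bar>y p - y t\<bar> < 1 / real (Suc k)"
        using x y(1) p(2) unfolding osc_def by blast+
      ultimately show ?thesis unfolding minus_bcontfun.rep_eq real_norm_def by linarith
    qed
    hence "norm (x - y) \<le> 3 * (1 / real (Suc k))" by (rule norm_bound)
    thus ?thesis using k unfolding y_def by (intro exI[of _ "(n, k, code n k x)"]) simp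
  qed
  hence "\<forall>x e. e > 0 \<longrightarrow> (\<exists>n. norm (x - D (from_nat n)) < e)" by (metis from_nat_to_nat)
  thus ?thesis by (intro exI[of _ "\<lambda>n. D (from_nat n)"])
qed

lemma convergent_if_approximable:
  fixes X :: "nat \<Rightarrow> real"
  assumes "\<And>e. e > 0 \<Longrightarrow> \<exists>Y. convergent Y \<and> (\<forall>n. \<bar>X n - Y n\<bar> < e)"
  shows "convergent X"
proof -
  have "Cauchy X"
  proof (rule metric_CauchyI)
    fix e :: real assume "e > 0"
    then obtain Y where Y: "convergent Y" "\<And>n. \<bar>X n - Y n\<bar> < e / 3" using assms[of "e/3"] by auto
    then obtain M where "\<And>m n. m \<ge> M \<Longrightarrow> n \<ge> M \<Longrightarrow> dist (Y m) (Y n) < e / 3"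
      using \<open>e > 0\<close> unfolding Cauchy_convergent_iff[symmetric] Cauchy_def
      by (meson divide_pos_pos zero_less_numeral)
    moreover have "dist (X m) (X n) < e" if "dist (Y m) (Y n) < e / 3" for m n
      using that Y(2)[of m] Y(2)[of n] unfolding dist_real_def by linarith
    ultimately show "\<exists>M. \<forall>m\<ge>M. \<forall>n\<ge>M. dist (X m) (X n) < e" by blast
  qed
  thus ?thesis by (simp add: Cauchy_convergent)
qed

text \<open>Each member of a dense sequence has a subsequence for its orbit hull; a diagonal one
  serves them all, and contractivity of the \<open>w n\<close> extends convergence to every
  \<open>x\<close>.\<close>

proposition tame_koopman_hull_subseq:
  fixes \<phi> :: "'a::metric_space \<Rightarrow> 'a"
  assumes cpt: "compact (UNIV :: 'a set)" and cont: "continuous_on UNIV \<phi>" and tame: "tame \<phi>"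
    and w: "\<And>n. w n \<in> koopman_hull \<phi>"
  obtains r :: "nat \<Rightarrow> nat"
  where "strict_mono r" "\<And>x t. convergent (\<lambda>n. blinfun_apply (w (r n)) x t)"
proof -
  obtain D :: "nat \<Rightarrow> 'a \<Rightarrow>\<^sub>C real" where D: "\<And>x e. e > 0 \<Longrightarrow> \<exists>n. norm (x - D n) < e"
    using bcontfun_separable[OF cpt] by blast
  interpret subseqs "\<lambda>j s. \<forall>t. convergent (\<lambda>n. blinfun_apply (w (s n)) (D j) t)"
  proof
    fix j and s :: "nat \<Rightarrow> nat"
    have K: "norm (blinfun_apply (op_pow (koopman \<phi>) k) (D j)) \<le> norm (D j)" for k
      by (intro koopman_hull_norm_le[OF cont] hull_inc) auto
    obtain r :: "nat \<Rightarrow> nat" where "strict_mono r" "\<And>t. convergent (\<lambda>n. blinfun_apply (w (s (r n))) (D j) t)"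
      using convex_hull_pointwise_convergent_subseq[OF cpt K tame_not_alternating[OF tame]
          koopman_hull_orbit[OF w], of s] by blast
    thus "\<exists>r'. strict_mono r' \<and> (\<forall>t. convergent (\<lambda>n. blinfun_apply (w ((s \<circ> r') n)) (D j) t))" by auto
  qed
  \<comment> \<open>Past its first \<open>j + 1\<close> entries the diagonal sequence is a
    subsequence of the one selected for \<open>D j\<close>.\<close>
  have diag: "\<forall>t. convergent (\<lambda>n. blinfun_apply (w ((diagseq \<circ> (+) (Suc j)) n)) (D j) t)" for j
  proof (rule diagseq_holds)
    show "\<forall>t. convergent (\<lambda>n. blinfun_apply (w ((s \<circ> r) n)) (D j) t)"
      if "strict_mono r" "\<forall>t. convergent (\<lambda>n. blinfun_apply (w (s n)) (D j) t)" for r s j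
    proof
      fix t
      show "convergent (\<lambda>n. blinfun_apply (w ((s \<circ> r) n)) (D j) t)"
        using convergent_subseq_convergent[OF that(2)[rule_format, of t] that(1)] by (simp add: comp_def)
    qed
  qed
  have conv_D: "convergent (\<lambda>n. blinfun_apply (w (diagseq n)) (D j) t)" for j t
    using convergent_ignore_initial_segment[of "\<lambda>n. blinfun_apply (w (diagseq n)) (D j) t" "Suc j"]
      diag[of j, rule_format, of t]
    by (simp add: comp_def add.commute)
  have "convergent (\<lambda>n. blinfun_apply (w (diagseq n)) x t)" for x t
  proof (rule convergent_if_approximable)
    fix e :: real assume "e > 0"
    then obtain j where j: "norm (x - D j) < e" using D by blast
    have "\<bar>blinfun_apply (w n) x t - blinfun_apply (w n) (D j) t\<bar> < e" for n
      using norm_bounded[of "blinfun_apply (w n) (x - D j)" t] koopman_hull_norm_le[OF cont w, of n "x - D j"] j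
      by (simp add: blinfun.diff_right)
    thus "\<exists>Y. convergent Y \<and> (\<forall>n. \<bar>blinfun_apply (w (diagseq n)) x t - Y n\<bar> < e)"
      using conv_D by blast
  qed
  thus thesis using that subseq_diagseq by blast
qed

text \<open>As the pointwise limits of \<open>w n x\<close> may leave C(\<Omega>), the limit
  operator is built on the dual: \<open>L \<mu> x\<close> is linear and bounded in each
  argument.\<close>

lemma wso_convergent_if_pointwise_convergent:
  fixes W :: "nat \<Rightarrow> 'a::metric_space opdualC"
  assumes cpt: "compact (UNIV :: 'a set)" and W: "\<And>n \<mu>. blinfun_apply (W n) \<mu> = \<mu> o\<^sub>L w n"
    and le: "\<And>n x. norm (blinfun_apply (w n) x) \<le> norm x"
    and conv: "\<And>x t. convergent (\<lambda>n. blinfun_apply (w n) x t)"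
  shows "wso_convergent W"
proof -
  define L where "L \<mu> x = lim (\<lambda>n. blinfun_apply \<mu> (blinfun_apply (w n) x))" for \<mu> :: "'a dualC" and x
  have L: "(\<lambda>n. blinfun_apply \<mu> (blinfun_apply (w n) x)) \<longlonglongrightarrow> L \<mu> x" for \<mu> x
    unfolding L_def convergent_LIMSEQ_iff[symmetric]
    by (rule pointwise_convergent_imp_weakly_convergent[OF cpt le conv])
  have L_eqI: "L \<mu> x = l" if "(\<lambda>n. blinfun_apply \<mu> (blinfun_apply (w n) x)) \<longlonglongrightarrow> l" for \<mu> x l
    using LIMSEQ_unique[OF L that] .
  have L_norm: "norm (L \<mu> x) \<le> norm \<mu> * norm x" for \<mu> x
  proof (rule LIMSEQ_le_const2[OF tendsto_norm[OF L]])
    have "norm (blinfun_apply \<mu> (blinfun_apply (w n) x)) \<le> norm \<mu> * norm x" for n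
      using norm_blinfun[of \<mu> "blinfun_apply (w n) x"] mult_left_mono[OF le, of "norm \<mu>" n x] by simp
    thus "\<exists>N. \<forall>n\<ge>N. norm (blinfun_apply \<mu> (blinfun_apply (w n) x)) \<le> norm \<mu> * norm x" by blast
  qed
  have "bounded_linear (L \<mu>)" for \<mu>
  proof (rule bounded_linear_intro)
    show "L \<mu> (x + y) = L \<mu> x + L \<mu> y" for x y
      by (rule L_eqI) (simp add: blinfun.add_right tendsto_add L)
    show "L \<mu> (c *\<^sub>R x) = c *\<^sub>R L \<mu> x" for c x
      by (rule L_eqI) (simp add: blinfun.scaleR_right tendsto_mult_left L)
    show "norm (L \<mu> x) \<le> norm x * norm \<mu>" for x using L_norm by (simp add: mult.commute)
  qed
  hence app: "blinfun_apply (Blinfun (L \<mu>)) x = L \<mu> x" for \<mu> x by (simp add: bounded_linear_Blinfun_apply)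
  have "bounded_linear (\<lambda>\<mu>. Blinfun (L \<mu>))"
  proof (rule bounded_linear_intro[where K=1])
    show "Blinfun (L (\<mu> + \<nu>)) = Blinfun (L \<mu>) + Blinfun (L \<nu>)" for \<mu> \<nu>
      by (rule blinfun_eqI) (auto simp: app blinfun.add_left intro!: L_eqI tendsto_add L)
    show "Blinfun (L (c *\<^sub>R \<mu>)) = c *\<^sub>R Blinfun (L \<mu>)" for c \<mu>
      by (rule blinfun_eqI) (auto simp: app blinfun.scaleR_left intro!: L_eqI tendsto_mult_left L)
    show "norm (Blinfun (L \<mu>)) \<le> norm \<mu> * 1" for \<mu>
      by (rule norm_blinfun_bound) (use L_norm in \<open>auto simp: app\<close>)
  qed
  hence "wso_tendsto W (Blinfun (\<lambda>\<mu>. Blinfun (L \<mu>)))"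
    unfolding wso_tendsto_def by (simp add: bounded_linear_Blinfun_apply app W L)
  thus ?thesis unfolding wso_convergent_def by blast
qed

subsection \<open>Sequences in pointwise closures of nets\<close>

lemma compact_UNIV_fun:
  assumes "compact (UNIV :: 'a::metric_space set)"
  shows "compact (UNIV :: ('i \<Rightarrow> 'a) set)"
proof -
  have "compact_space (euclidean :: 'a topology)" using assms by (simp add: compact_space_def)
  hence "compact_space (product_topology (\<lambda>_::'i. euclidean :: 'a topology) UNIV)"
    by (simp add: compact_space_product_topology)
  thus ?thesis by (simp add: euclidean_product_topology compact_space_def)
qed

text \<open>The conditions on \<open>p\<close> are open in the compact space of sequences, so
  finitely many indices serve all tuples at once.\<close>

lemma finite_subset_small_on_tuples:
  fixes f :: "nat \<Rightarrow> 'i \<Rightarrow> 'a::metric_space \<Rightarrow>\<^sub>C real"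
  assumes cpt: "compact (UNIV :: 'a set)"
    and "\<And>p :: nat \<Rightarrow> 'a. \<exists>i\<in>A. \<forall>k<n. \<forall>j<n. \<bar>f j i (p k)\<bar> < e"
  obtains F where "finite F" "F \<subseteq> A" "\<And>p. \<exists>i\<in>F. \<forall>k<n. \<forall>j<n. \<bar>f j i (p k)\<bar> < e"
proof -
  define Z where "Z i = (\<Inter>k\<in>{..<n}. \<Inter>j\<in>{..<n}. {p :: nat \<Rightarrow> 'a. \<bar>f j i (p k)\<bar> < e})" for i
  have coord: "continuous_on UNIV (\<lambda>p :: nat \<Rightarrow> 'a. f j i (p k))" for j i k
    by (rule continuous_on_compose2[of UNIV "apply_bcontfun (f j i)"]) auto
  have "open {p :: nat \<Rightarrow> 'a. \<bar>f j i (p k)\<bar> < e}" for j i k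
    by (intro open_Collect_less continuous_on_rabs coord continuous_on_const)
  hence "open (Z i)" for i
    unfolding Z_def by (intro open_INT ballI) auto
  moreover have "UNIV \<subseteq> (\<Union>i\<in>A. Z i)" unfolding Z_def using assms(2) by fastforce
  ultimately obtain F where F: "F \<subseteq> A" "finite F" "UNIV \<subseteq> (\<Union>i\<in>F. Z i)"
    using compactE_image[OF compact_UNIV_fun[OF cpt], of A Z] by metis
  have "\<exists>i\<in>F. \<forall>k<n. \<forall>j<n. \<bar>f j i (p k)\<bar> < e" for p
  proof -
    obtain i where "i \<in> F" "p \<in> Z i" using F(3) by blast
    thus ?thesis unfolding Z_def by (intro bexI[of _ i]) auto
  qed
  thus thesis using that F by blast
qed

text \<open>The scheme argument with smallness at all but finitely many indices as goodness. A
  scheme would realise small and large values alternately along a subsequence supplied by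
  \<open>subseq\<close>, at a point where it converges.\<close>

proposition pointwise_null_sequence_from_closure:
  fixes f :: "nat \<Rightarrow> 'i \<Rightarrow> 'a::metric_space \<Rightarrow>\<^sub>C real"
  assumes cpt: "compact (UNIV :: 'a set)"
    and subseq: "\<And>j a. \<exists>r :: nat \<Rightarrow> nat. strict_mono r \<and> (\<forall>x. convergent (\<lambda>n. f j (a (r n)) x))"
    and closure: "\<And>m p. \<exists>i. \<forall>k<m. \<forall>j<m. \<bar>f j i (p k)\<bar> < 1 / real (Suc m)"
  shows "\<exists>a :: nat \<Rightarrow> 'i. \<forall>j x. (\<lambda>n. f j (a n) x) \<longlonglongrightarrow> 0"
proof -
  \<comment> \<open>0 lies in the pointwise closure of the family indexed by \<open>A\<close>, for all \<open>f j\<close> simultaneously.\<close>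
  define pos where "pos A \<longleftrightarrow> (\<forall>m p. \<exists>i\<in>A. \<forall>k<m. \<forall>j<m. \<bar>f j i (p k)\<bar> < 1 / real (Suc m))" for A
  have pos_UNIV: "pos UNIV" unfolding pos_def using closure by blast
  have pos_mono: "pos B" if "pos A" "A \<subseteq> B" for A B using that unfolding pos_def by blast
  \<comment> \<open>Partition regularity: if tuples witness failure for \<open>A\<close> and for
    \<open>B\<close>, their concatenation witnesses it for the union.\<close>
  have pos_Un: "pos A \<or> pos B" if "pos (A \<union> B)" for A B
  proof (rule ccontr)
    assume "\<not> ?thesis"
    hence "\<not> pos A" "\<not> pos B" by auto
    from \<open>\<not> pos A\<close> have "\<exists>m p. \<forall>i\<in>A. \<exists>k<m. \<exists>j<m. \<not> \<bar>f j i (p k)\<bar> < 1 / real (Suc m)"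
      unfolding pos_def by (simp del: of_nat_Suc)
    then obtain m p
      where A: "\<And>i. i \<in> A \<Longrightarrow> \<exists>k<m. \<exists>j<m. \<not> \<bar>f j i (p k)\<bar> < 1 / real (Suc m)"
      by metis
    from \<open>\<not> pos B\<close> have "\<exists>m p. \<forall>i\<in>B. \<exists>k<m. \<exists>j<m. \<not> \<bar>f j i (p k)\<bar> < 1 / real (Suc m)"
      unfolding pos_def by (simp del: of_nat_Suc)
    then obtain m' p'
      where B: "\<And>i. i \<in> B \<Longrightarrow> \<exists>k<m'. \<exists>j<m'. \<not> \<bar>f j i (p' k)\<bar> < 1 / real (Suc m')"
      by metis
    obtain i where i: "i \<in> A \<union> B"
      "\<And>k j. k < m + m' \<Longrightarrow> j < m + m' \<Longrightarrow>
         \<bar>f j i ((if k < m then p k else p' (k - m)))\<bar> < 1 / real (Suc (m + m'))"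
      using \<open>pos (A \<union> B)\<close>[unfolded pos_def, rule_format, of "m + m'" "\<lambda>k. if k < m then p k else p' (k - m)"]
      by blast
    show False
    proof (cases "i \<in> A")
      case True
      then obtain k j where kj: "k < m" "j < m" "\<not> \<bar>f j i (p k)\<bar> < 1 / real (Suc m)" using A by blast
      moreover have "1 / real (Suc (m + m')) \<le> 1 / real (Suc m)" by (intro divide_left_mono) auto
      ultimately show False using i(2)[of k j] by simp
    next
      case False
      then obtain k j where kj: "k < m'" "j < m'" "\<not> \<bar>f j i (p' k)\<bar> < 1 / real (Suc m')" using B i(1) by blast
      moreover have "1 / real (Suc (m + m')) \<le> 1 / real (Suc m')" by (intro divide_left_mono) auto
      ultimately show False using i(2)[of "k + m" j] by simp
    qed
  qed
  show ?thesis
  proof (cases "\<exists>i. pos {i}")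
    \<comment> \<open>A positive singleton forces all \<open>f j i\<close> to vanish, so a constant
      sequence will do; otherwise finite sets are not positive and can be discarded.\<close>
    case True
    then obtain i where i: "pos {i}" by blast
    have "f j i x = 0" for j x
    proof (rule ccontr)
      assume "f j i x \<noteq> 0"
      then obtain m where m: "1 / real (Suc m) < \<bar>f j i x\<bar>" using nat_approx_posE[of "\<bar>f j i x\<bar>"] by auto
      have "\<bar>f j i x\<bar> < 1 / real (Suc (Suc (j + m)))"
        using i[unfolded pos_def, rule_format, of "Suc (j + m)" "\<lambda>_. x"] by auto
      also have "\<dots> \<le> 1 / real (Suc m)" by (intro divide_left_mono) auto
      finally show False using m by simp
    qed
    thus ?thesis by (intro exI[of _ "\<lambda>_. i"]) simp
  next
    case False
    have not_pos_finite: "\<not> pos F" if "finite F" for F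
      using that
    proof induction
      case empty show ?case unfolding pos_def by blast
    next
      case (insert i F) thus ?case using pos_Un[of "{i}" F] False by auto
    qed
    define gd where "gd e A x \<longleftrightarrow> finite {i\<in>A. \<bar>f (fst e) i x\<bar> > 1 / real (Suc (snd e))}"
      for e :: "nat \<times> nat" and A x
    define E where "E e b i = (if b then {x. \<bar>f (fst e) i x\<bar> < 1 / (2 * real (Suc (snd e)))}
      else {x. 1 / real (Suc (snd e)) < \<bar>f (fst e) i x\<bar>})" for e :: "nat \<times> nat" and b i
    show ?thesis
    proof (rule cantor_scheme_dichotomy[OF cpt, of pos gd E])
      show "pos UNIV" by fact
      show "A \<noteq> {}" if "pos A" for A using that not_pos_finite[of "{}"] by auto
      show "pos (A - F)" if "pos A" "finite F" for A F
        using pos_Un[of "A - F" F] not_pos_finite[OF that(2)] pos_mono[OF that(1), of "A - F \<union> F"] by blast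
      show "gd e B x" if "gd e A x" "finite (B - A)" for e A B x
      proof -
        have "{i\<in>B. \<bar>f (fst e) i x\<bar> > 1 / real (Suc (snd e))} \<subseteq>
            {i\<in>A. \<bar>f (fst e) i x\<bar> > 1 / real (Suc (snd e))} \<union> (B - A)" by blast
        thus ?thesis using that unfolding gd_def by (meson finite_UnI finite_subset)
      qed
      show "open (E e b i)" for e b i
        unfolding E_def by (auto intro!: open_Collect_less continuous_intros)
      show "\<exists>B. pos B \<and> (\<forall>n. finite (B - A n))" if A: "\<And>n. pos (A n)" "decseq A" for A :: "nat \<Rightarrow> 'i set"
      proof -
        \<comment> \<open>Finite pieces \<open>F n\<close> that treat all \<open>n\<close>-tuples
          suffice for positivity, and their union leaves \<open>A n\<close> only within the pieces
          before \<open>n\<close>.\<close>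
        have "\<exists>F. finite F \<and> F \<subseteq> A n \<and> (\<forall>p. \<exists>i\<in>F. \<forall>k<n. \<forall>j<n. \<bar>f j i (p k)\<bar> < 1 / real (Suc n))" for n
          using finite_subset_small_on_tuples[OF cpt, of "A n" n f "1 / real (Suc n)"] A(1)[of n]
          unfolding pos_def by metis
        then obtain F where F: "\<And>n. finite (F n)" "\<And>n. F n \<subseteq> A n"
          "\<And>n p. \<exists>i\<in>F n. \<forall>k<n. \<forall>j<n. \<bar>f j i (p k)\<bar> < 1 / real (Suc n)" by metis
        have "pos (\<Union>n. F n)"
          unfolding pos_def
        proof (intro allI)
          fix m and p :: "nat \<Rightarrow> 'a"
          obtain i where "i \<in> F m" "\<forall>k<m. \<forall>j<m. \<bar>f j i (p k)\<bar> < 1 / real (Suc m)"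
            using F(3)[where n=m and p=p] by blast
          thus "\<exists>i\<in>\<Union>n. F n. \<forall>k<m. \<forall>j<m. \<bar>f j i (p k)\<bar> < 1 / real (Suc m)"
            by (intro bexI[of _ i]) auto
        qed
        moreover have "finite ((\<Union>n. F n) - A n)" for n
        proof (rule finite_subset)
          have "F m \<subseteq> A n" if "n \<le> m" for m using F(2) decseqD[OF A(2) that] by blast
          thus "(\<Union>n. F n) - A n \<subseteq> (\<Union>m<n. F m)" by (auto simp: not_less[symmetric])
        qed (use F(1) in auto)
        ultimately show ?thesis by blast
      qed
      show "\<exists>B\<subseteq>A. pos B \<and> (\<forall>i\<in>B. \<forall>b. S \<inter> E e b i \<noteq> {})"
        if A: "pos A" and S: "S \<noteq> {}" "\<And>B. pos B \<Longrightarrow> B \<subseteq> A \<Longrightarrow> \<exists>x\<in>S. \<not> gd e B x" for e A S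
      proof -
        obtain x0 where x0: "x0 \<in> S" using S(1) by blast
        \<comment> \<open>\<open>C\<close> collects the indices never large on \<open>S\<close>,
          \<open>D\<close> those not small at \<open>x0\<close>; removing these two non-positive
          sets leaves indices that split \<open>S\<close>.\<close>
        define C where "C = {i\<in>A. \<forall>x\<in>S. \<bar>f (fst e) i x\<bar> \<le> 1 / real (Suc (snd e))}"
        define D where "D = {i\<in>A. \<bar>f (fst e) i x0\<bar> \<ge> 1 / (2 * real (Suc (snd e)))}"
        have "\<not> pos C"
        proof
          assume "pos C"
          then obtain x where "x \<in> S" "\<not> gd e C x" using S(2)[of C] unfolding C_def by blast
          moreover have "{i\<in>C. \<bar>f (fst e) i x\<bar> > 1 / real (Suc (snd e))} = {}"
            using calculation(1) unfolding C_def by (auto simp: not_less)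
          ultimately show False unfolding gd_def by (metis finite.emptyI)
        qed
        moreover have "\<not> pos D"
        proof
          assume "pos D"
          \<comment> \<open>Large enough for \<open>fst e\<close> to be among the first
            \<open>m\<close> functions and for \<open>1 / (m+1)\<close> to be at most the threshold
            in \<open>D\<close>.\<close>
          define m where "m = Suc (fst e + 2 * Suc (snd e))"
          obtain i where "i \<in> D" "\<bar>f (fst e) i x0\<bar> < 1 / real (Suc m)"
            using \<open>pos D\<close>[unfolded pos_def, rule_format, of m "\<lambda>_. x0"] unfolding m_def by auto
          moreover have "1 / real (Suc m) \<le> 1 / (2 * real (Suc (snd e)))"
            unfolding m_def by (intro divide_left_mono) auto
          ultimately show False unfolding D_def by simp
        qed
        moreover have "A = (A - C - D) \<union> (C \<union> D)" unfolding C_def D_def by blast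
        ultimately have "pos (A - C - D)" using A pos_Un by metis
        moreover have "S \<inter> E e b i \<noteq> {}" if "i \<in> A - C - D" for i b
          using that x0 unfolding C_def D_def E_def by (cases b) (auto simp: not_le)
        ultimately show ?thesis by (intro exI[of _ "A - C - D"]) auto
      qed
    next
      fix A assume A: "pos A" "\<And>e x. gd e A x"
      have "infinite A" using A(1) not_pos_finite by blast
      then obtain a :: "nat \<Rightarrow> 'i" where a: "inj a" "range a \<subseteq> A" using infinite_countable_subset by blast
      have "(\<lambda>n. f j (a n) x) \<longlonglongrightarrow> 0" for j x
      proof (rule tendstoI)
        fix e :: real assume "e > 0"
        then obtain k where k: "1 / real (Suc k) < e" using nat_approx_posE by blast
        have "a ` {n. \<bar>f j (a n) x\<bar> > 1 / real (Suc k)} \<subseteq> {i\<in>A. \<bar>f j i x\<bar> > 1 / real (Suc k)}"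
          using a(2) by blast
        hence "finite {n. \<bar>f j (a n) x\<bar> > 1 / real (Suc k)}"
          using A(2)[of "(j, k)" x] a(1) unfolding gd_def fst_conv snd_conv
          by (meson finite_imageD finite_subset inj_on_subset subset_UNIV)
        hence "eventually (\<lambda>n. \<not> \<bar>f j (a n) x\<bar> > 1 / real (Suc k)) sequentially"
          by (simp only: cofinite_eq_sequentially[symmetric] eventually_cofinite not_not)
        thus "eventually (\<lambda>n. dist (f j (a n) x) 0 < e) sequentially"
          by eventually_elim (use k in simp)
      qed
      thus ?thesis by blast
    next
      fix e and a :: "nat \<Rightarrow> 'i" and w assume w: "\<And>s n. w s \<in> E e (s n) (a n)"
      obtain r :: "nat \<Rightarrow> nat" where r: "strict_mono r" "\<And>x. convergent (\<lambda>n. f (fst e) (a (r n)) x)"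
        using subseq by blast
      \<comment> \<open>The digits are chosen so that along \<open>r\<close> the values are small at
        even and large at odd places.\<close>
      define x where "x = w (\<lambda>i. even (inv r i))"
      have x: "x \<in> E e (even n) (a (r n))" for n
        using w[of "\<lambda>i. even (inv r i)" "r n"] inv_f_f[OF strict_mono_imp_inj_on[OF r(1)], of n]
        unfolding x_def by simp
      obtain l where "(\<lambda>n. f (fst e) (a (r n)) x) \<longlonglongrightarrow> l" using r(2) convergent_def by blast
      hence lim: "(\<lambda>n. \<bar>f (fst e) (a (r n)) x\<bar>) \<longlonglongrightarrow> \<bar>l\<bar>" by (rule tendsto_rabs)
      have "\<bar>l\<bar> \<le> 1 / (2 * real (Suc (snd e)))"
      proof (rule LIMSEQ_le_const2)
        show "(\<lambda>n. \<bar>f (fst e) (a (r (2 * n))) x\<bar>) \<longlonglongrightarrow> \<bar>l\<bar>"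
          using LIMSEQ_subseq_LIMSEQ[OF lim, of "\<lambda>n. 2 * n"] by (simp add: comp_def strict_mono_def)
        have "\<bar>f (fst e) (a (r (2 * n))) x\<bar> \<le> 1 / (2 * real (Suc (snd e)))" for n
          using x[of "2 * n"] unfolding E_def by simp
        thus "\<exists>N. \<forall>n\<ge>N. \<bar>f (fst e) (a (r (2 * n))) x\<bar> \<le> 1 / (2 * real (Suc (snd e)))" by blast
      qed
      moreover have "1 / real (Suc (snd e)) \<le> \<bar>l\<bar>"
      proof (rule LIMSEQ_le_const)
        show "(\<lambda>n. \<bar>f (fst e) (a (r (2 * n + 1))) x\<bar>) \<longlonglongrightarrow> \<bar>l\<bar>"
          using LIMSEQ_subseq_LIMSEQ[OF lim, of "\<lambda>n. 2 * n + 1"] by (simp add: comp_def strict_mono_def)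
        have "1 / real (Suc (snd e)) \<le> \<bar>f (fst e) (a (r (2 * n + 1))) x\<bar>" for n
          using x[of "2 * n + 1"] unfolding E_def by simp
        thus "\<exists>N. \<forall>n\<ge>N. 1 / real (Suc (snd e)) \<le> \<bar>f (fst e) (a (r (2 * n + 1))) x\<bar>" by blast
      qed
      ultimately have "1 / real (Suc (snd e)) \<le> 1 / (2 * real (Suc (snd e)))"
        by (rule order_trans[rotated])
      thus ?thesis by (simp add: field_simps)
    qed
  qed
qed

subsection \<open>Ergodic nets\<close>

lemma directed_preorder_finite_eventually:
  assumes dir: "directed_preorder le" and "finite T"
    and ev: "\<And>t. t \<in> T \<Longrightarrow> \<exists>a0. \<forall>a. le a0 a \<longrightarrow> P t a"
  shows "\<exists>a0. \<forall>a. le a0 a \<longrightarrow> (\<forall>t\<in>T. P t a)"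
  using assms(2) ev
proof (induction T)
  case (insert t T)
  then obtain a0 a1 where a: "\<And>a. le a0 a \<Longrightarrow> \<forall>t\<in>T. P t a" "\<And>a. le a1 a \<Longrightarrow> P t a"
    by (metis insertCI)
  obtain c where "le a0 c" "le a1 c" using dir unfolding directed_preorder_def by blast
  hence "\<forall>a. le c a \<longrightarrow> le a0 a \<and> le a1 a" using dir unfolding directed_preorder_def by blast
  thus ?case using a by blast
qed blast

lemma net_tendsto_sequentially: "net_tendsto (\<le>) X L \<longleftrightarrow> X \<longlonglongrightarrow> L"
  unfolding net_tendsto_def LIMSEQ_iff by simp

text \<open>Passing to the preadjoint makes \<open>w\<close> act after \<open>Id - U\<close>, so
  ergodicity becomes weak convergence of \<open>w (x - U x)\<close> to 0 along the net.\<close>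

lemma ergodic_net_pairing:
  assumes "\<And>\<mu>. blinfun_apply W \<mu> = \<mu> o\<^sub>L w"
  shows "blinfun_apply (blinfun_apply ((id_blinfun - dual_koopman \<phi>) o\<^sub>L W) \<mu>) x =
    blinfun_apply \<mu> (blinfun_apply w (x - blinfun_apply (koopman \<phi>) x))"
  by (simp add: assms blinfun.diff_left blinfun.diff_right dual_koopman_apply)

lemma ex_point_evaluation: "\<exists>\<mu> :: 'a::metric_space dualC. \<forall>x. blinfun_apply \<mu> x = apply_bcontfun x t"
proof -
  have "bounded_linear (\<lambda>x :: 'a \<Rightarrow>\<^sub>C real. apply_bcontfun x t)"
  proof (rule bounded_linear_intro[where K=1])
    show "norm (apply_bcontfun x t) \<le> norm x * 1" for x :: "'a \<Rightarrow>\<^sub>C real"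
      using norm_bounded[of x t] by simp
  qed auto
  thus ?thesis by (intro exI[of _ "Blinfun (\<lambda>x. apply_bcontfun x t)"]) (simp add: bounded_linear_Blinfun_apply)
qed

text \<open>Tested on point evaluations, ergodicity puts 0 in the pointwise closure, jointly for a
  dense sequence of \<open>x\<close>. The extracted sequence is pointwise null on all
  \<open>x - U x\<close>, hence weakly null there.\<close>

theorem tame_ergodic_net_ergodic_sequence:
  fixes \<phi> :: "'a::metric_space \<Rightarrow> 'a" and W :: "'i \<Rightarrow> 'a opdualC"
  assumes cpt: "compact (UNIV :: 'a set)" and cont: "continuous_on UNIV \<phi>" and tame: "tame \<phi>"
    and dir: "directed_preorder le" and erg: "ergodic_net \<phi> le W"
  shows "\<exists>\<alpha> :: nat \<Rightarrow> 'i. ergodic_seq \<phi> (W \<circ> \<alpha>)"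
proof -
  let ?U = "blinfun_apply (koopman \<phi>)"
  have hull: "W i \<in> convex hull (range (op_pow (dual_koopman \<phi>)))" for i
    using erg unfolding ergodic_net_def by blast
  obtain w where w: "\<And>i. w i \<in> koopman_hull \<phi>" "\<And>i \<mu>. blinfun_apply (W i) \<mu> = \<mu> o\<^sub>L w i"
    using dual_koopman_hull_preadjoint[OF hull] by metis
  have net: "net_tendsto le (\<lambda>i. blinfun_apply \<mu> (blinfun_apply (w i) (x - ?U x))) 0" for \<mu> x
    using erg unfolding ergodic_net_def by (simp only: ergodic_net_pairing[OF w(2)])
  obtain D :: "nat \<Rightarrow> 'a \<Rightarrow>\<^sub>C real" where D: "\<And>x e. e > 0 \<Longrightarrow> \<exists>n. norm (x - D n) < e"
    using bcontfun_separable[OF cpt] by blast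
  define f where "f j i = blinfun_apply (w i) (D j - ?U (D j))" for j i
  have "\<exists>\<alpha> :: nat \<Rightarrow> 'i. \<forall>j t. (\<lambda>n. f j (\<alpha> n) t) \<longlonglongrightarrow> 0"
  proof (rule pointwise_null_sequence_from_closure[OF cpt])
    fix j and a :: "nat \<Rightarrow> 'i"
    obtain r :: "nat \<Rightarrow> nat" where "strict_mono r" "\<And>x t. convergent (\<lambda>n. blinfun_apply (w (a (r n))) x t)"
      using tame_koopman_hull_subseq[OF cpt cont tame, of "\<lambda>n. w (a n)"] w(1) by blast
    thus "\<exists>r :: nat \<Rightarrow> nat. strict_mono r \<and> (\<forall>x. convergent (\<lambda>n. f j (a (r n)) x))"
      unfolding f_def by blast
  next
    fix m and p :: "nat \<Rightarrow> 'a"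
    have "\<exists>a0. \<forall>a. le a0 a \<longrightarrow> (\<forall>t\<in>{..<m} \<times> {..<m}. \<bar>f (snd t) a (p (fst t))\<bar> < 1 / real (Suc m))"
    proof (rule directed_preorder_finite_eventually[OF dir])
      fix t :: "nat \<times> nat"
      obtain \<mu> :: "'a dualC" where "\<And>x. blinfun_apply \<mu> x = apply_bcontfun x (p (fst t))"
        using ex_point_evaluation by blast
      moreover have "1 / real (Suc m) > 0" by simp
      ultimately show "\<exists>a0. \<forall>a. le a0 a \<longrightarrow> \<bar>f (snd t) a (p (fst t))\<bar> < 1 / real (Suc m)"
        using net[of \<mu> "D (snd t)", unfolded net_tendsto_def, rule_format, of "1 / real (Suc m)"]
        unfolding f_def by simp
    qed auto
    moreover have "\<And>a. le a a" using dir unfolding directed_preorder_def by blast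
    ultimately show "\<exists>i. \<forall>k<m. \<forall>j<m. \<bar>f j i (p k)\<bar> < 1 / real (Suc m)" by fastforce
  qed
  then obtain \<alpha> :: "nat \<Rightarrow> 'i" where \<alpha>: "\<And>j t. (\<lambda>n. f j (\<alpha> n) t) \<longlonglongrightarrow> 0" by blast
  have null: "(\<lambda>n. blinfun_apply (w (\<alpha> n)) (x - ?U x) t) \<longlonglongrightarrow> 0" for x t
  proof (rule tendstoI)
    fix e :: real assume "e > 0"
    \<comment> \<open>Half of \<open>e / 2\<close>, because \<open>Id - U\<close> at most doubles
      the norm.\<close>
    then obtain j where j: "norm (x - D j) < e / 4" using D[of "e/4" x] by auto
    have U_le: "norm (?U y) \<le> norm y" for y
      using norm_bounded[of y] by (intro norm_bound) (simp add: koopman_apply[OF cont])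
    have close: "\<bar>blinfun_apply (w i) (x - ?U x) t - f j i t\<bar> < e / 2" for i
    proof -
      have "blinfun_apply (w i) (x - ?U x) - f j i = blinfun_apply (w i) ((x - D j) - ?U (x - D j))"
        unfolding f_def by (simp add: blinfun.diff_right)
      moreover have "norm (blinfun_apply (w i) ((x - D j) - ?U (x - D j))) \<le> 2 * norm (x - D j)"
        using koopman_hull_norm_le[OF cont w(1), of i "(x - D j) - ?U (x - D j)"]
          norm_triangle_ineq4[of "x - D j" "?U (x - D j)"] U_le[of "x - D j"] by linarith
      ultimately have "norm (blinfun_apply (w i) (x - ?U x) - f j i) < e / 2" using j by simp
      thus ?thesis using norm_bounded[of "blinfun_apply (w i) (x - ?U x) - f j i" t] by simp
    qed
    have "eventually (\<lambda>n. dist (f j (\<alpha> n) t) 0 < e / 2) sequentially"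
      by (rule tendstoD[OF \<alpha> half_gt_zero[OF \<open>e > 0\<close>]])
    thus "eventually (\<lambda>n. dist (blinfun_apply (w (\<alpha> n)) (x - ?U x) t) 0 < e) sequentially"
    proof eventually_elim
      case (elim n)
      thus ?case using close[of "\<alpha> n"] unfolding dist_real_def diff_0_right by linarith
    qed
  qed
  have "(\<lambda>n. blinfun_apply \<mu> (blinfun_apply (w (\<alpha> n)) (x - ?U x))) \<longlonglongrightarrow> 0"
    for \<mu> :: "'a dualC" and x
    using pointwise_null_imp_weakly_null[OF cpt, of "\<lambda>n. blinfun_apply (w (\<alpha> n)) (x - ?U x)" "norm (x - ?U x)" \<mu>]
      koopman_hull_norm_le[OF cont w(1)] null by blast
  hence "ergodic_seq \<phi> (W \<circ> \<alpha>)"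
    unfolding ergodic_seq_def ergodic_net_def net_tendsto_sequentially comp_def
    using hull by (simp only: ergodic_net_pairing[OF w(2)]) blast
  thus ?thesis by blast
qed

text \<open>Stated for arbitrary sequences in the hull, so that it covers ergodic sequences and
  Cesaro means alike.\<close>

theorem tame_hull_wso_convergent_subseq:
  fixes \<phi> :: "'a::metric_space \<Rightarrow> 'a"
  assumes cpt: "compact (UNIV :: 'a set)" and cont: "continuous_on UNIV \<phi>" and tame: "tame \<phi>"
    and hull: "\<And>n. W n \<in> convex hull (range (op_pow (dual_koopman \<phi>)))"
  shows "\<exists>r :: nat \<Rightarrow> nat. strict_mono r \<and> wso_convergent (W \<circ> r)"
proof -
  obtain w where w: "\<And>n. w n \<in> koopman_hull \<phi>" "\<And>n \<mu>. blinfun_apply (W n) \<mu> = \<mu> o\<^sub>L w n"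
    using dual_koopman_hull_preadjoint[OF hull] by metis
  obtain r :: "nat \<Rightarrow> nat" where r: "strict_mono r" "\<And>x t. convergent (\<lambda>n. blinfun_apply (w (r n)) x t)"
    by (rule tame_koopman_hull_subseq[OF cpt cont tame, of w, OF w(1)]) (use that in blast)
  have "wso_convergent (W \<circ> r)"
    by (rule wso_convergent_if_pointwise_convergent[OF cpt, of _ "\<lambda>n. w (r n)"])
      (use w r(2) koopman_hull_norm_le[OF cont w(1)] in \<open>auto simp: comp_def\<close>)
  thus ?thesis using r(1) by blast
qed

lemma ergodic_seq_subseq:
  assumes "ergodic_seq \<phi> W" "strict_mono r"
  shows "ergodic_seq \<phi> (W \<circ> r)"
  using assms LIMSEQ_subseq_LIMSEQ[OF _ assms(2)]
  unfolding ergodic_seq_def ergodic_net_def net_tendsto_sequentially by (force simp: comp_def)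

lemma cesaro_in_hull: "cesaro \<phi> n \<in> convex hull (range (op_pow (dual_koopman \<phi>)))"
proof -
  have "(\<Sum>k\<le>n. (1 / real (n + 1)) *\<^sub>R op_pow (dual_koopman \<phi>) k) \<in> convex hull (range (op_pow (dual_koopman \<phi>)))"
    by (rule convex_sum) (auto intro: hull_inc)
  thus ?thesis unfolding cesaro_def by (simp add: scaleR_sum_right)
qed

theorem theorem3p3:
  fixes \<phi> :: "'a::metric_space \<Rightarrow> 'a"
  assumes "compact (UNIV :: 'a set)"
    and "continuous_on UNIV \<phi>"
    and "tame \<phi>"
  shows "(\<forall>le W. directed_preorder (le :: 'i \<Rightarrow> 'i \<Rightarrow> bool) \<longrightarrow> ergodic_net \<phi> le W \<longrightarrow>
            (\<exists>\<alpha> :: nat \<Rightarrow> 'i. ergodic_seq \<phi> (W \<circ> \<alpha>) \<and> wso_convergent (W \<circ> \<alpha>)))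
       \<and> (\<forall>W. ergodic_seq \<phi> W \<longrightarrow>
            (\<exists>r. strict_mono r \<and> ergodic_seq \<phi> (W \<circ> r) \<and> wso_convergent (W \<circ> r)))
       \<and> (\<exists>r. strict_mono r \<and> wso_convergent (cesaro \<phi> \<circ> r))"
proof -
  note subseq = tame_hull_wso_convergent_subseq[OF assms]
  have seq: "\<exists>r. strict_mono r \<and> ergodic_seq \<phi> (W \<circ> r) \<and> wso_convergent (W \<circ> r)"
    if "ergodic_seq \<phi> W" for W
    using subseq[of W] ergodic_seq_subseq[OF that] that unfolding ergodic_seq_def ergodic_net_def by blast
  have "\<exists>\<alpha> :: nat \<Rightarrow> 'i. ergodic_seq \<phi> (W \<circ> \<alpha>) \<and> wso_convergent (W \<circ> \<alpha>)"
    if net: "directed_preorder (le :: 'i \<Rightarrow> 'i \<Rightarrow> bool)" "ergodic_net \<phi> le W" for le W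
  proof -
    obtain \<alpha> :: "nat \<Rightarrow> 'i" where "ergodic_seq \<phi> (W \<circ> \<alpha>)"
      using tame_ergodic_net_ergodic_sequence[OF assms net] by blast
    \<comment> \<open>The extracted sequence is itself ergodic, so the sequential case applies to it
      and the two selections of indices compose.\<close>
    from seq[OF this] show ?thesis by (metis comp_assoc)
  qed
  thus ?thesis using seq subseq[of "cesaro \<phi>"] cesaro_in_hull by blast
qed

end
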